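(* Let $p$ be a prime, $q$ a power of $p$, $n\ge1$, and write $n=p^em$ with $p\nmid m$. Let $h_{p,n}\in\mathbb F_p[X_1,\dots,X_n]$ be the polynomial defined in the context. Let $f=X^n+a_1X^{n-1}+\cdots+a_n\in\mathbb F_q[X]$ be irreducible. If $h_{p,n}(a_1,\dots,a_n)\ne0$, then $f$ is normal over $\mathbb F_q$, i.e., its roots are linearly independent over $\mathbb F_q$.
   Context: For $l\ge1$ let $\epsilon_l=e^{2\pi\sqrt{-1}/l}$ and $\Psi_l(X_0,\dots,X_{l-1})=\prod_{i\in(\mathbb Z/l\mathbb Z)^\times}\bigl(\sum_{j\in\mathbb Z/l\mathbb Z}\epsilon_l^{ij}X_j\bigr)\in\mathbb Z[X_0,\dots,X_{l-1}]$. Let $S_l$ act on polynomials by $\sigma(X_j)=X_{\sigma(j)}$, let $\mathcal C_l$ be a system of representatives of the left cosets of the stabilizer of $\Psi_l$ in $S_l$, and $\Phi_l=\prod_{\sigma\in\mathcal C_l}\sigma(\Psi_l)$ (symmetric, in $\mathbb Z[X_0,\dots,X_{l-1}]$). For $l\mid n$, let $\mathcal P_{n,l}$ be the set of unordered partitions of $\{0,\dots,n-1\}$ into $l$ parts $P_0,\dots,P_{l-1}$ of size $n/l$, and $\Theta_{n,l}=\prod_{\{P_0,\dots,P_{l-1}\}\in\mathcal P_{n,l}}\Phi_l\bigl(\sum_{a\in P_0}X_a,\dots,\sum_{a\in P_{l-1}}X_a\bigr)$, a symmetric polynomial in $\mathbb Z[X_0,\dots,X_{n-1}]$; let $\theta_{n,l}\in\mathbb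 Z[X_1,\dots,X_n]$ be the unique polynomial with $\Theta_{n,l}=\theta_{n,l}(s_1,\dots,s_n)$, $s_i$ the $i$-th elementary symmetric polynomial in $X_0,\dots,X_{n-1}$. For $l\mid m$, let $\theta_{p,n,l}\in\mathbb F_p[X_1,\dots,X_n]$ be the reduction of $\theta_{n,l}$ modulo $p$, and $h_{p,n}=\prod_{l\mid m}\theta_{p,n,l}$. *)

theory Defs
  imports Complex_Main "HOL-Library.Poly_Mapping" "HOL-Library.Disjoint_Sets"
    "HOL-Combinatorics.Permutations" "HOL-Computational_Algebra.Computational_Algebra"
begin

type_synonym 'a mpoly = "(nat \<Rightarrow>\<^sub>0 nat) \<Rightarrow>\<^sub>0 'a"

definition mvar :: "nat \<Rightarrow> 'a::comm_ring_1 mpoly" where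
  "mvar i = Poly_Mapping.single (Poly_Mapping.single i 1) 1"

definition mconst :: "'a::comm_ring_1 \<Rightarrow> 'a mpoly" where
  "mconst c = Poly_Mapping.single 0 c"

definition mp_eval :: "('a::comm_ring_1 \<Rightarrow> 'b::comm_ring_1) \<Rightarrow> (nat \<Rightarrow> 'b) \<Rightarrow> 'a mpoly \<Rightarrow> 'b" where
  "mp_eval h v P = (\<Sum>m\<in>Poly_Mapping.keys P. h (Poly_Mapping.lookup P m) * (\<Prod>i\<in>Poly_Mapping.keys m. v i ^ Poly_Mapping.lookup m i))"

definition mp_subst :: "(nat \<Rightarrow> 'a::comm_ring_1 mpoly) \<Rightarrow> 'a mpoly \<Rightarrow> 'a mpoly" where
  "mp_subst v P = mp_eval mconst v P"

definition eps :: "nat \<Rightarrow> complex" where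
  "eps l = cis (2 * pi / real l)"

text \<open>Psi_l; (Z/lZ)^x is represented by {i < l. coprime i l} (for l = 1 this is {0}).\<close>
definition Psi :: "nat \<Rightarrow> complex mpoly" where
  "Psi l = (\<Prod>i\<in>{i. i < l \<and> coprime i l}. (\<Sum>j<l. mconst (eps l ^ (i * j)) * mvar j))"

definition perm_act :: "(nat \<Rightarrow> nat) \<Rightarrow> complex mpoly \<Rightarrow> complex mpoly" where
  "perm_act \<sigma> P = mp_subst (\<lambda>j. mvar (\<sigma> j)) P"

text \<open>Phi_l: product of sigma(Psi_l) over representatives sigma of the left cosets of the
  stabilizer of Psi_l in S_l, i.e. the product over the distinct elements of the S_l-orbit.\<close>
definition Phi :: "nat \<Rightarrow> complex mpoly" where
  "Phi l = \<Prod>{perm_act \<sigma> (Psi l) | \<sigma>. \<sigma> permutes {..<l}}"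

definition part_set :: "nat \<Rightarrow> nat \<Rightarrow> nat set set set" where
  "part_set n l = {Q. partition_on {..<n} Q \<and> card Q = l \<and> (\<forall>B\<in>Q. card B = n div l)}"

definition part_enum :: "nat \<Rightarrow> nat set set \<Rightarrow> nat \<Rightarrow> nat set" where
  "part_enum l Q = (SOME P. bij_betw P {..<l} Q)"

definition Theta :: "nat \<Rightarrow> nat \<Rightarrow> complex mpoly" where
  "Theta n l = (\<Prod>Q\<in>part_set n l.
      mp_subst (\<lambda>j. if j < l then (\<Sum>a\<in>part_enum l Q j. mvar a) else 0) (Phi l))"

definition esym :: "nat \<Rightarrow> nat \<Rightarrow> complex mpoly" where
  "esym n i = (\<Sum>S\<in>{S. S \<subseteq> {..<n} \<and> card S = i}. \<Prod>a\<in>S. mvar a)"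

definition theta :: "nat \<Rightarrow> nat \<Rightarrow> int mpoly" where
  "theta n l = (THE P. (\<forall>m\<in>Poly_Mapping.keys P. Poly_Mapping.keys m \<subseteq> {1..n}) \<and>
      mp_eval (\<lambda>c. mconst (of_int c)) (esym n) P = Theta n l)"

text \<open>h_{p,n}(a_1,...,a_n) for a_1..a_n in a field of characteristic p: the reduction mod p
  of theta_{n,l} evaluated at a is mp_eval of_int a (theta n l), since F_p is the prime field.\<close>
definition h_eval :: "nat \<Rightarrow> nat \<Rightarrow> (nat \<Rightarrow> 'a::comm_ring_1) \<Rightarrow> 'a" where
  "h_eval p n a = (let m = n div p ^ multiplicity p n in
     \<Prod>l\<in>{l. l dvd m}. mp_eval of_int a (theta n l))"

end

theory Submission
  imports "HOL-Algebra.Algebraic_Closure_Type" Defs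
begin

text \<open>If the roots \<open>r\<^sub>i = r^(q^i)\<close> of \<open>f\<close> are dependent over \<open>\<bbbF>\<^sub>q\<close>, the relations among their
  cyclic shifts form an ideal strictly larger than \<open>(X^n - 1)\<close>, so that \<open>\<Sum> \<omega>^i r\<^sub>i = 0\<close> for some
  \<open>\<omega>\<close> with \<open>\<omega>^n = 1\<close> in an algebraic closure. The order \<open>l\<close> of \<open>\<omega>\<close> is prime to \<open>p\<close>, hence divides \<open>m\<close>, and
  collecting indices modulo \<open>l\<close> exhibits a vanishing linear factor of \<open>\<Psi>\<^sub>l\<close> at the block sums of one
  partition, whence \<open>\<theta>\<^sub>p\<^sub>,\<^sub>n\<^sub>,\<^sub>l\<close> vanishes at the coefficients of \<open>f\<close>. To make sense of this in
  characteristic \<open>p\<close>, \<open>\<Psi>\<^sub>l\<close> has to be integral with the expected reduction: it is a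
  symmetric function of the primitive \<open>l\<close>-th roots of unity, thus an integral polynomial in the coefficients of
  the cyclotomic polynomial. Since \<open>a\<^sub>i\<close> is the \<open>i\<close>-th elementary symmetric function of the
  \<open>- r\<^sub>j\<close>, the evaluation point is \<open>- r\<close>.\<close>

section \<open>Ring morphisms and evaluation\<close>

text \<open>The obstacle is that \<open>theta\<close> is singled out by a definite description over
  the complex numbers, whereas its value is wanted in characteristic p, and no ring morphism leads
  there from the complex coefficients. Hence nothing is reduced directly. The relation
  \<open>int_value\<close> ties a complex polynomial to the value that an integral lift of it takes
  at a point of the other field. It respects differences and products, and one factor with value 0
  annihilates \<open>Theta\<close>, provided that every other factor has some value at all. This is
  why integrality is established for every member of the orbit of \<Psi> and every partition, not
  only for the vanishing one. Symmetric polynomials enter twice, with different coefficients: for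
  the roots of unity over Z[X], and for the variables X over Z. The theorem on them therefore works
  with generated subrings over an arbitrary set \<open>A\<close> and expresses symmetry by the
  existence of suitable ring morphisms.\<close>

locale ring_morphism =
  fixes h :: "'a::comm_ring_1 \<Rightarrow> 'b::comm_ring_1"
  assumes map_1 [simp]: "h 1 = 1"
    and map_add: "h (x + y) = h x + h y"
    and map_mult: "h (x * y) = h x * h y"
begin

lemma map_0 [simp]: "h 0 = 0"
  using map_add[of 0 0] by simp

lemma map_uminus: "h (- x) = - h x"
  using map_add[of x "- x"] by (simp add: eq_neg_iff_add_eq_0 add.commute)

lemma map_diff: "h (x - y) = h x - h y"
  using map_add[of x "- y"] by (simp add: map_uminus)

lemma map_sum: "h (\<Sum>i\<in>A. g i) = (\<Sum>i\<in>A. h (g i))"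
  by (induction A rule: infinite_finite_induct) (auto simp: map_add)

lemma map_prod: "h (\<Prod>i\<in>A. g i) = (\<Prod>i\<in>A. h (g i))"
  by (induction A rule: infinite_finite_induct) (auto simp: map_mult)

lemma map_power: "h (x ^ k) = h x ^ k"
  by (induction k) (auto simp: map_mult)

lemma map_of_nat [simp]: "h (of_nat k) = of_nat k"
  by (induction k) (auto simp: map_add)

lemma map_of_int [simp]: "h (of_int k) = of_int k"
  by (cases k) (auto simp: map_uminus map_diff)

lemma map_mp_eval: "h (mp_eval g v P) = mp_eval (\<lambda>c. h (g c)) (\<lambda>i. h (v i)) P"
  by (simp add: mp_eval_def map_sum map_mult map_prod map_power)

end

lemma ring_morphism_id: "ring_morphism (\<lambda>x. x)"
  by unfold_locales auto

lemma ring_morphism_comp: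
  "ring_morphism g \<Longrightarrow> ring_morphism h \<Longrightarrow> ring_morphism (\<lambda>x. g (h x))"
  by (simp add: ring_morphism_def)

lemma ring_morphism_of_int: "ring_morphism (of_int :: int \<Rightarrow> 'a::comm_ring_1)"
  by unfold_locales auto

lemma ring_morphism_mconst: "ring_morphism mconst"
  by unfold_locales (auto simp: mconst_def single_add mult_single)

lemma ring_morphism_mconst_of_int: "ring_morphism (\<lambda>c. mconst (of_int c))"
  by (rule ring_morphism_comp[OF ring_morphism_mconst ring_morphism_of_int])

section \<open>Evaluation is a ring morphism\<close>

definition mon_eval :: "(nat \<Rightarrow> 'b::comm_ring_1) \<Rightarrow> (nat \<Rightarrow>\<^sub>0 nat) \<Rightarrow> 'b" where
  "mon_eval v m = (\<Prod>i\<in>Poly_Mapping.keys m. v i ^ Poly_Mapping.lookup m i)"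

text \<open>Indices outside the support have exponent 0 and contribute a factor 1, so two monomials
  can be expanded over one common index set.\<close>

lemma mon_eval_superset:
  assumes "finite A" "Poly_Mapping.keys m \<subseteq> A"
  shows "mon_eval v m = (\<Prod>i\<in>A. v i ^ Poly_Mapping.lookup m i)"
  unfolding mon_eval_def
  by (rule prod.mono_neutral_left) (use assms in \<open>auto simp: in_keys_iff\<close>)

lemma mon_eval_add: "mon_eval v (m + k) = mon_eval v m * mon_eval v k"
proof -
  let ?A = "Poly_Mapping.keys m \<union> Poly_Mapping.keys k"
  have "mon_eval v (m + k) = (\<Prod>i\<in>?A. v i ^ Poly_Mapping.lookup (m + k) i)"
    by (rule mon_eval_superset) (use keys_add[of m k] in auto)
  also have "\<dots> = mon_eval v m * mon_eval v k"
    by (simp add: mon_eval_superset[of ?A] lookup_add power_add prod.distrib)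
  finally show ?thesis .
qed

lemma mp_eval_mon: "mp_eval h v P = (\<Sum>m\<in>Poly_Mapping.keys P. h (Poly_Mapping.lookup P m) * mon_eval v m)"
  by (simp add: mp_eval_def mon_eval_def)

context ring_morphism
begin

lemma mp_eval_superset:
  assumes "finite A" "Poly_Mapping.keys P \<subseteq> A"
  shows "mp_eval h v P = (\<Sum>m\<in>A. h (Poly_Mapping.lookup P m) * mon_eval v m)"
  unfolding mp_eval_mon
  by (rule sum.mono_neutral_left) (use assms in \<open>auto simp: in_keys_iff\<close>)

lemma mp_eval_add: "mp_eval h v (P + Q) = mp_eval h v P + mp_eval h v Q"
proof -
  let ?A = "Poly_Mapping.keys P \<union> Poly_Mapping.keys Q"
  have "mp_eval h v (P + Q) = (\<Sum>m\<in>?A. h (Poly_Mapping.lookup (P + Q) m) * mon_eval v m)"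
    by (rule mp_eval_superset) (use keys_add[of P Q] in auto)
  also have "\<dots> = mp_eval h v P + mp_eval h v Q"
    by (simp add: mp_eval_superset[of ?A] lookup_add map_add algebra_simps sum.distrib)
  finally show ?thesis .
qed

lemma mp_eval_0 [simp]: "mp_eval h v 0 = 0"
  by (simp add: mp_eval_def)

lemma mp_eval_sum: "mp_eval h v (\<Sum>i\<in>A. g i) = (\<Sum>i\<in>A. mp_eval h v (g i))"
  by (induction A rule: infinite_finite_induct) (auto simp: mp_eval_add)

lemma mp_eval_single: "mp_eval h v (Poly_Mapping.single m c) = h c * mon_eval v m"
  by (subst mp_eval_superset[of "{m}"]) auto

end

lemma poly_mapping_sum_single:
  "P = (\<Sum>m\<in>Poly_Mapping.keys P. Poly_Mapping.single m (Poly_Mapping.lookup P m))"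
proof (rule poly_mapping_eqI)
  fix k
  have "(\<Sum>m\<in>Poly_Mapping.keys P. Poly_Mapping.lookup P m when m = k) = Poly_Mapping.lookup P k"
    by (cases "k \<in> Poly_Mapping.keys P")
      (auto simp: when_def sum.delta in_keys_iff intro!: sum.neutral)
  then show "Poly_Mapping.lookup P k =
      Poly_Mapping.lookup (\<Sum>m\<in>Poly_Mapping.keys P. Poly_Mapping.single m (Poly_Mapping.lookup P m)) k"
    by (simp add: lookup_sum lookup_single)
qed

context ring_morphism
begin

lemma mp_eval_mult: "mp_eval h v (P * Q) = mp_eval h v P * mp_eval h v Q"
proof -
  let ?s = "\<lambda>P m. Poly_Mapping.single m (Poly_Mapping.lookup P m)"
  have "P * Q = (\<Sum>m\<in>Poly_Mapping.keys P. ?s P m) * (\<Sum>k\<in>Poly_Mapping.keys Q. ?s Q k)"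
    by (simp flip: poly_mapping_sum_single)
  also have "\<dots> = (\<Sum>m\<in>Poly_Mapping.keys P. \<Sum>k\<in>Poly_Mapping.keys Q. 
      Poly_Mapping.single (m + k) (Poly_Mapping.lookup P m * Poly_Mapping.lookup Q k))"
    by (simp add: sum_product mult_single)
  finally have "mp_eval h v (P * Q) = (\<Sum>m\<in>Poly_Mapping.keys P. \<Sum>k\<in>Poly_Mapping.keys Q.
      (h (Poly_Mapping.lookup P m) * mon_eval v m) * (h (Poly_Mapping.lookup Q k) * mon_eval v k))"
    by (simp add: mp_eval_sum mp_eval_single map_mult mon_eval_add mult_ac)
  then show ?thesis
    by (simp add: mp_eval_mon sum_product)
qed

lemma mp_eval_mconst [simp]: "mp_eval h v (mconst c) = h c"
  by (simp add: mconst_def mp_eval_single mon_eval_def)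

lemma mp_eval_mvar [simp]: "mp_eval h v (mvar i) = v i"
  by (simp add: mvar_def mp_eval_single mon_eval_def)

lemma ring_morphism_mp_eval: "ring_morphism (mp_eval h v)"
proof
  show "mp_eval h v 1 = 1"
    using mp_eval_mconst[of v 1] by (simp add: mconst_def)
qed (auto simp: mp_eval_add mp_eval_mult)

lemma mp_eval_subst: "mp_eval h v (mp_subst w P) = mp_eval h (\<lambda>i. mp_eval h v (w i)) P"
proof -
  interpret E: ring_morphism "mp_eval h v" by (rule ring_morphism_mp_eval)
  show ?thesis by (simp add: mp_subst_def E.map_mp_eval)
qed

end

lemma mp_eval_cong:
  assumes "\<And>m i. m \<in> Poly_Mapping.keys P \<Longrightarrow> i \<in> Poly_Mapping.keys m \<Longrightarrow> v i = w i"
  shows "mp_eval h v P = mp_eval h w P"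
  unfolding mp_eval_def using assms by (intro sum.cong refl arg_cong2[where f = "(*)"] prod.cong) auto

lemma ring_morphism_mp_subst: "ring_morphism (mp_subst v)"
  using ring_morphism.ring_morphism_mp_eval[OF ring_morphism_mconst] by (simp add: mp_subst_def [abs_def])

lemma mp_subst_subst: "mp_subst v (mp_subst w P) = mp_subst (\<lambda>i. mp_subst v (w i)) P"
  using ring_morphism.mp_eval_subst[OF ring_morphism_mconst] by (simp add: mp_subst_def)

lemma mp_subst_mvar [simp]: "mp_subst v (mvar i) = v i"
  by (simp add: mp_subst_def ring_morphism.mp_eval_mvar[OF ring_morphism_mconst])

lemma mp_subst_mconst [simp]: "mp_subst v (mconst c) = mconst c"
  by (simp add: mp_subst_def ring_morphism.mp_eval_mconst[OF ring_morphism_mconst])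

lemma mvar_eq_iff [simp]: "(mvar i :: 'a::comm_ring_1 mpoly) = mvar j \<longleftrightarrow> i = j"
proof
  assume "(mvar i :: 'a mpoly) = mvar j"
  then have "Poly_Mapping.keys (mvar i :: 'a mpoly) = Poly_Mapping.keys (mvar j :: 'a mpoly)" by simp
  then have "Poly_Mapping.single i (1::nat) = Poly_Mapping.single j 1"
    by (simp add: mvar_def)
  then have "Poly_Mapping.keys (Poly_Mapping.single i (1::nat)) = Poly_Mapping.keys (Poly_Mapping.single j (1::nat))"
    by simp
  then show "i = j" by simp
qed simp

section \<open>Elementary symmetric functions\<close>

text \<open>Formed from elements of an arbitrary ring instead of variables, so that a morphism
  carries \<open>esym\<close> to the same expression at the images.\<close>

definition elem_sym :: "nat \<Rightarrow> (nat \<Rightarrow> 'a::comm_ring_1) \<Rightarrow> nat \<Rightarrow> 'a" where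
  "elem_sym n x i = (\<Sum>S\<in>{S. S \<subseteq> {..<n} \<and> card S = i}. \<Prod>a\<in>S. x a)"

lemma esym_eq_elem_sym: "esym n i = elem_sym n mvar i"
  by (simp add: esym_def elem_sym_def)

lemma elem_sym_0 [simp]: "elem_sym n x 0 = 1"
proof -
  have "{S. S \<subseteq> {..<n} \<and> card S = 0} = {{}}"
    by (auto dest: finite_subset)
  then show ?thesis by (simp add: elem_sym_def)
qed

lemma elem_sym_0_Suc [simp]: "elem_sym 0 x (Suc i) = 0"
proof -
  have "{S. S \<subseteq> {..<0::nat} \<and> card S = Suc i} = {}" by auto
  then show ?thesis by (simp only: elem_sym_def sum.empty)
qed

lemma elem_sym_Suc:
  "elem_sym (Suc n) x (Suc i) = elem_sym n x (Suc i) + x n * elem_sym n x i"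
proof -
  let ?P = "\<lambda>n i. {S. S \<subseteq> {..<n} \<and> card S = (i::nat)}"
  have fin: "finite (?P n i)" for n i :: nat
    by (rule finite_subset[of _ "Pow {..<n}"]) auto
  have split: "?P (Suc n) (Suc i) = ?P n (Suc i) \<union> insert n ` ?P n i"
  proof (intro equalityI subsetI)
    fix S assume S: "S \<in> ?P (Suc n) (Suc i)"
    then have finS: "finite S" by (auto dest: finite_subset)
    show "S \<in> ?P n (Suc i) \<union> insert n ` ?P n i"
    proof (cases "n \<in> S")
      case True
      then have "S = insert n (S - {n})" "S - {n} \<in> ?P n i"
        using S finS by (auto simp: less_Suc_eq)
      then show ?thesis by blast
    next
      case False
      then show ?thesis using S by (auto simp: less_Suc_eq subset_iff)
    qed
  next
    fix S assume "S \<in> ?P n (Suc i) \<union> insert n ` ?P n i"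
    then show "S \<in> ?P (Suc n) (Suc i)"
    proof
      assume "S \<in> insert n ` ?P n i"
      then obtain S' where S': "S = insert n S'" "S' \<subseteq> {..<n}" "card S' = i" by auto
      moreover have "finite S'" "n \<notin> S'" using S' finite_subset by auto
      ultimately show ?thesis by (auto simp: card_insert_if)
    qed (auto simp: less_Suc_eq)
  qed
  have "inj_on (insert n) (?P n i)"
    by (rule inj_onI) (auto simp: insert_eq_iff[where a = n and b = n] dest: insert_ident)
  moreover have "(\<Prod>a\<in>insert n S. x a) = x n * (\<Prod>a\<in>S. x a)" if "S \<in> ?P n i" for S
    using that by (subst prod.insert) (auto dest: finite_subset)
  ultimately have "(\<Sum>S\<in>insert n ` ?P n i. \<Prod>a\<in>S. x a) = x n * elem_sym n x i"
    by (simp add: sum.reindex elem_sym_def sum_distrib_left)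
  moreover have "?P n (Suc i) \<inter> insert n ` ?P n i = {}" by auto
  ultimately show ?thesis
    unfolding elem_sym_def split by (subst sum.union_disjoint) (auto simp: fin)
qed

lemma elem_sym_eq_0: "n < i \<Longrightarrow> elem_sym n x i = 0"
proof (induction n arbitrary: i)
  case 0
  then show ?case by (cases i) auto
next
  case (Suc n)
  then show ?case by (cases i) (auto simp: elem_sym_Suc)
qed

lemma elem_sym_cong:
  assumes "\<And>a. a < n \<Longrightarrow> x a = y a"
  shows "elem_sym n x i = elem_sym n y i"
  unfolding elem_sym_def using assms by (intro sum.cong prod.cong) auto

lemma elem_sym_permutes:
  assumes "\<pi> permutes {..<n}"
  shows "elem_sym n (\<lambda>a. x (\<pi> a)) i = elem_sym n x i"
proof -
  let ?P = "{S. S \<subseteq> {..<n} \<and> card S = i}"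
  have inj: "inj \<pi>" using assms by (rule permutes_inj)
  have inv: "inv_into UNIV \<pi> permutes {..<n}" using assms by (rule permutes_inv)
  have "elem_sym n x i = (\<Sum>S\<in>?P. \<Prod>a\<in>\<pi> ` S. x a)"
    unfolding elem_sym_def
  proof (rule sum.reindex_bij_witness[where i = "image \<pi>" and j = "image (inv_into UNIV \<pi>)"])
    fix S assume S: "S \<in> ?P"
    show "\<pi> ` inv_into UNIV \<pi> ` S = S"
      using assms by (simp add: image_image permutes_inverses)
    show "inv_into UNIV \<pi> ` S \<in> ?P"
      using S permutes_image[OF inv] by (auto simp: card_image inj_on_subset[OF permutes_inj[OF inv]])
    show "inv_into UNIV \<pi> ` \<pi> ` S = S"
      using assms by (simp add: image_image permutes_inverses)
    show "\<pi> ` S \<in> ?P"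
      using S permutes_image[OF assms] by (auto simp: card_image inj_on_subset[OF inj])
  qed (use assms in \<open>simp add: image_image permutes_inverses\<close>)
  also have "\<dots> = elem_sym n (\<lambda>a. x (\<pi> a)) i"
    by (simp add: elem_sym_def prod.reindex inj_on_subset[OF inj])
  finally show ?thesis by simp
qed

lemma (in ring_morphism) map_elem_sym: "h (elem_sym n x i) = elem_sym n (\<lambda>a. h (x a)) i"
  by (simp add: elem_sym_def map_sum map_prod)

lemma elem_sym_uminus: "elem_sym n (\<lambda>a. - x a) i = (- 1) ^ i * elem_sym n x i"
  by (simp add: elem_sym_def sum_distrib_left prod_uminus)

section \<open>Polynomials under morphisms, and the coefficients of a product of linear
  factors\<close>

lemma (in ring_morphism) map_poly_add: "map_poly h (p + q) = map_poly h p + map_poly h q"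
  by (rule poly_eqI) (simp add: coeff_map_poly map_add)

lemma (in ring_morphism) map_poly_mult: "map_poly h (p * q) = map_poly h p * map_poly h q"
  by (rule poly_eqI) (simp add: coeff_map_poly coeff_mult map_sum map_mult)

lemma (in ring_morphism) map_poly_prod: "map_poly h (\<Prod>i\<in>A. p i) = (\<Prod>i\<in>A. map_poly h (p i))"
  by (induction A rule: infinite_finite_induct) (simp_all add: map_poly_mult)

lemma (in ring_morphism) map_poly_monom_diff_1: "map_poly h (monom 1 l - 1) = monom 1 l - 1"
  by (rule poly_eqI) (simp add: coeff_map_poly coeff_1 map_diff)

lemma degree_prod_linear: "degree (\<Prod>i\<in>A. [:x i, 1:]) = card A" for x :: "'i \<Rightarrow> 'a::idom"
  by (simp add: degree_prod_sum_eq)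

lemma lead_coeff_prod_linear: "lead_coeff (\<Prod>i\<in>A. [:x i, 1:]) = 1" for x :: "'i \<Rightarrow> 'a::idom"
  by (simp add: lead_coeff_prod)

text \<open>Vieta's formulas for the roots - x a, a convention under which no signs appear.
  Expanding the last factor reproduces the recursion \<open>elem_sym_Suc\<close>.\<close>

lemma coeff_prod_linear:
  fixes x :: "nat \<Rightarrow> 'a::idom"
  assumes "i \<le> n"
  shows "coeff (\<Prod>a<n. [:x a, 1:]) (n - i) = elem_sym n x i"
  using assms
proof (induction n arbitrary: i)
  case 0
  then show ?case by simp
next
  case (Suc n)
  show ?case
  proof (cases i)
    case 0
    then show ?thesis
      using lead_coeff_prod_linear[of x "{..<Suc n}"]
      by (metis card_lessThan degree_prod_linear diff_zero elem_sym_0)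
  next
    case i: (Suc j)
    let ?p = "\<Prod>a<n. [:x a, 1:]"
    have j: "j \<le> n" using Suc.prems i by simp
    have "coeff (?p * [:x n, 1:]) (n - j) = x n * coeff ?p (n - j) + (if n - j = 0 then 0 else coeff ?p (n - j - 1))"
      by (cases "n - j") (auto simp: coeff_pCons)
    \<comment> \<open>For j = n the missing lower coefficient is matched by
      \<open>elem_sym n x (Suc n)\<close> = 0.\<close>
    moreover have "(if n - j = 0 then 0 else coeff ?p (n - j - 1)) = elem_sym n x (Suc j)"
      using Suc.IH[of "Suc j"] j by (auto simp: elem_sym_eq_0)
    ultimately show ?thesis
      using Suc.IH[OF j] i by (simp add: elem_sym_Suc)
  qed
qed

section \<open>Subrings and the fundamental theorem on symmetric polynomials\<close>

text \<open>The generated subring: with 1 and differences it contains the integers, so variables as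
  generators give integral polynomials. The closure rules mirror the assumptions of
  \<open>subring_rel\<close>.\<close>

inductive_set ring_gen :: "'a::comm_ring_1 set \<Rightarrow> 'a set" for A where
  gen_base: "a \<in> A \<Longrightarrow> a \<in> ring_gen A"
| gen_1: "1 \<in> ring_gen A"
| gen_diff: "a \<in> ring_gen A \<Longrightarrow> b \<in> ring_gen A \<Longrightarrow> a - b \<in> ring_gen A"
| gen_mult: "a \<in> ring_gen A \<Longrightarrow> b \<in> ring_gen A \<Longrightarrow> a * b \<in> ring_gen A"

lemma gen_0: "0 \<in> ring_gen A"
  using gen_diff[OF gen_1 gen_1] by simp

lemma gen_uminus: "a \<in> ring_gen A \<Longrightarrow> - a \<in> ring_gen A"
  using gen_diff[OF gen_0] by simp

lemma gen_add: "a \<in> ring_gen A \<Longrightarrow> b \<in> ring_gen A \<Longrightarrow> a + b \<in> ring_gen A"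
  using gen_diff[OF _ gen_uminus] by simp

lemma gen_sum: "(\<And>i. i \<in> I \<Longrightarrow> g i \<in> ring_gen A) \<Longrightarrow> (\<Sum>i\<in>I. g i) \<in> ring_gen A"
  by (induction I rule: infinite_finite_induct) (auto intro: gen_0 gen_add)

lemma gen_prod: "(\<And>i. i \<in> I \<Longrightarrow> g i \<in> ring_gen A) \<Longrightarrow> (\<Prod>i\<in>I. g i) \<in> ring_gen A"
  by (induction I rule: infinite_finite_induct) (auto intro: gen_1 gen_mult)

lemma gen_power: "a \<in> ring_gen A \<Longrightarrow> a ^ k \<in> ring_gen A"
  by (induction k) (auto intro: gen_1 gen_mult)

lemma ring_gen_least:
  assumes "a \<in> ring_gen A" "A \<subseteq> ring_gen B"
  shows "a \<in> ring_gen B"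
  using assms(1) by induction (use assms(2) in \<open>auto intro: ring_gen.intros\<close>)

lemma ring_morphism_fixes_ring_gen:
  assumes "ring_morphism h" "a \<in> ring_gen A" "\<And>b. b \<in> A \<Longrightarrow> h b = b"
  shows "h a = a"
proof -
  interpret ring_morphism h by fact
  show ?thesis using assms(2)
    by induction (auto simp: assms(3) map_diff map_mult)
qed

text \<open>Cancelling leading terms against a monic divisor never divides coefficients, so the
  remainder stays over the subring. With \<open>UNIV\<close> as generators this is also the integral
  division behind the cyclotomic polynomials.\<close>

lemma division_by_monic:
  fixes g M :: "'a::comm_ring_1 poly"
  assumes "lead_coeff M = 1" "\<And>i. coeff M i \<in> ring_gen B" "\<And>i. coeff g i \<in> ring_gen B"
  shows "\<exists>k r. g = M * k + r \<and> (r = 0 \<or> degree r < degree M) \<and> (\<forall>i. coeff r i \<in> ring_gen B)"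
  using assms(3)
\<comment> \<open>The measure separates 0 from the nonzero constants, which have degree 0 as
  well.\<close>
proof (induction "if g = 0 then 0 else Suc (degree g)" arbitrary: g rule: less_induct)
  case less
  show ?case
  proof (cases "g = 0 \<or> degree g < degree M")
    case True
    then show ?thesis using less.prems by (intro exI[of _ 0] exI[of _ g]) auto
  next
    case False
    then have g0: "g \<noteq> 0" and deg: "degree M \<le> degree g" by auto
    define t where "t = monom (lead_coeff g) (degree g - degree M)"
    define g' where "g' = g - M * t"
    have top: "coeff (M * t) (degree g) = lead_coeff g"
      using deg assms(1) by (simp add: t_def mult.commute[of M] coeff_monom_mult)
    have "degree (M * t) \<le> degree g"
      using degree_mult_le[of M t] degree_monom_le[of "lead_coeff g" "degree g - degree M"] deg
      by (simp add: t_def)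
    then have dle: "degree g' \<le> degree g" by (simp add: g'_def degree_diff_le)
    have "coeff g' (degree g) = 0" by (simp add: g'_def top)
    then have small: "g' = 0 \<or> degree g' < degree g"
      using dle by (metis leading_coeff_0_iff le_neq_implies_less)
    have "coeff g' i \<in> ring_gen B" for i
      unfolding g'_def t_def mult.commute[of M] coeff_diff coeff_monom_mult
      using less.prems assms(2) by (auto intro!: gen_diff gen_mult gen_0)
    moreover have "(if g' = 0 then 0 else Suc (degree g')) < (if g = 0 then 0 else Suc (degree g))"
      using small g0 by auto
    ultimately obtain k r where "g' = M * k + r" "r = 0 \<or> degree r < degree M" "\<forall>i. coeff r i \<in> ring_gen B"
      using less.hyps[of g'] by blast
    then show ?thesis
      by (intro exI[of _ "k + t"] exI[of _ r]) (auto simp: g'_def algebra_simps)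
  qed
qed

text \<open>Isolates the last x_n as the variable of a univariate polynomial, to which division
  applies.\<close>

lemma ring_gen_insert_poly:
  assumes "f \<in> ring_gen (insert t B)"
  shows "\<exists>g. f = poly g t \<and> (\<forall>i. coeff g i \<in> ring_gen B)"
  using assms
proof induction
  case (gen_base a)
  show ?case
  proof (cases "a = t")
    case True
    then show ?thesis
      by (intro exI[of _ "[:0, 1:]"]) (auto simp: coeff_pCons gen_0 gen_1 split: nat.splits)
  next
    case False
    then show ?thesis using gen_base
      by (intro exI[of _ "[:a:]"]) (auto simp: coeff_pCons gen_0 ring_gen.gen_base split: nat.splits)
  qed
next
  case gen_1
  show ?case
    by (intro exI[of _ 1]) (auto simp: coeff_1 gen_0 ring_gen.gen_1)
next
  case (gen_diff a b)
  then obtain g g' where "a = poly g t" "b = poly g' t" "\<forall>i. coeff g i \<in> ring_gen B" "\<forall>i. coeff g' i \<in> ring_gen B"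
    by blast
  then show ?case
    by (intro exI[of _ "g - g'"]) (auto intro: ring_gen.gen_diff)
next
  case (gen_mult a b)
  then obtain g g' where "a = poly g t" "b = poly g' t" "\<forall>i. coeff g i \<in> ring_gen B" "\<forall>i. coeff g' i \<in> ring_gen B"
    by blast
  then show ?case
    by (intro exI[of _ "g * g'"]) (auto simp: coeff_mult intro!: ring_gen.gen_mult gen_sum)
qed

text \<open>Artin's argument: modulo the monic polynomial with roots \<open>x\<^sub>0, \<dots>, x\<^sub>n\<close>, an element
  symmetric in \<open>x\<^sub>0, \<dots>, x\<^sub>n\<close> becomes a polynomial of degree at most \<open>n\<close> in \<open>x\<^sub>n\<close> whose coefficients
  are fixed by all permutations. It takes the same value at the \<open>n + 1\<close> points \<open>x\<^sub>j\<close>,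
  hence is constant.\<close>

theorem symmetric_in_ring_gen_elem_sym:
  fixes x :: "nat \<Rightarrow> 'a::idom"
  assumes "inj_on x {..<n}"
    and "\<And>\<pi>. \<pi> permutes {..<n} \<Longrightarrow>
      \<exists>h. ring_morphism h \<and> (\<forall>a\<in>A. h a = a) \<and> (\<forall>i<n. h (x i) = x (\<pi> i)) \<and> h f = f"
    and "f \<in> ring_gen (A \<union> x ` {..<n})"
  shows "f \<in> ring_gen (A \<union> elem_sym n x ` {1..n})"
  using assms
proof (induction n arbitrary: A)
  case 0
  then show ?case by simp
next
  case (Suc n)
  \<comment> \<open>\<open>B\<close> generates the target ring. The induction hypothesis only
    reaches this ring with x_n adjoined; the division below removes x_n again.\<close>
  define B where "B = A \<union> elem_sym (Suc n) x ` {1..Suc n}"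
  have esB: "elem_sym (Suc n) x i \<in> ring_gen B" for i
  proof -
    consider "i = 0" | "i > Suc n" | "i \<in> {1..Suc n}" by fastforce
    then show ?thesis
      by cases (auto simp: B_def elem_sym_eq_0 gen_0 gen_1 intro: gen_base)
  qed
  have "f \<in> ring_gen (insert (x n) A \<union> elem_sym n x ` {1..n})"
  proof (rule Suc.IH)
    show "inj_on x {..<n}" using Suc.prems(1) by (rule inj_on_subset) auto
    show "f \<in> ring_gen (insert (x n) A \<union> x ` {..<n})"
      using Suc.prems(3) by (simp add: lessThan_Suc)
    fix \<pi> assume \<pi>: "\<pi> permutes {..<n}"
    then have "\<pi> permutes {..<Suc n}" by (rule permutes_subset) auto
    moreover have "\<pi> n = n" using \<pi> by (simp add: permutes_def)
    ultimately show "\<exists>h. ring_morphism h \<and> (\<forall>a\<in>insert (x n) A. h a = a) \<and> (\<forall>i<n. h (x i) = x (\<pi> i)) \<and> h f = f"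
      using Suc.prems(2)[of \<pi>] by (metis insert_iff less_Suc_eq)
  qed
  \<comment> \<open>Solving the recursion backwards expresses the elementary symmetric functions
    without x_n by those with x_n and by x_n itself.\<close>
  moreover have "elem_sym n x i \<in> ring_gen (insert (x n) B)" for i
  proof (induction i)
    case 0
    show ?case by (simp add: gen_1)
  next
    case (Suc i)
    have "elem_sym n x (Suc i) = elem_sym (Suc n) x (Suc i) - x n * elem_sym n x i"
      by (simp add: elem_sym_Suc)
    moreover have "elem_sym (Suc n) x (Suc i) \<in> ring_gen (insert (x n) B)"
      by (rule ring_gen_least[OF esB]) (auto intro: gen_base)
    ultimately show ?case
      using Suc by (auto intro!: gen_diff gen_mult intro: gen_base)
  qed
  ultimately have "f \<in> ring_gen (insert (x n) B)"
    by (rule_tac ring_gen_least) (auto simp: B_def intro: gen_base)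
  then obtain g where g: "f = poly g (x n)" "\<And>i. coeff g i \<in> ring_gen B"
    using ring_gen_insert_poly by blast
  define M where "M = (\<Prod>a<Suc n. [:- x a, 1:])"
  have M: "lead_coeff M = 1" "degree M = Suc n"
    using lead_coeff_prod_linear[of "\<lambda>a. - x a" "{..<Suc n}"] degree_prod_linear[of "\<lambda>a. - x a" "{..<Suc n}"]
    by (simp_all add: M_def del: prod.lessThan_Suc)
  have Mroot: "poly M (x j) = 0" if "j \<le> n" for j
    using that by (auto simp: M_def poly_prod simp del: prod.lessThan_Suc)
  have "elem_sym (Suc n) (\<lambda>a. - x a) i \<in> ring_gen B" for i
    unfolding elem_sym_uminus by (intro gen_mult gen_power gen_uminus gen_1 esB)
  then have Mcoeff: "coeff M i \<in> ring_gen B" for i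
  proof (cases "i \<le> Suc n")
    case True
    then show ?thesis
      using coeff_prod_linear[of "Suc n - i" "Suc n" "\<lambda>a. - x a"] \<open>\<And>i. elem_sym (Suc n) (\<lambda>a. - x a) i \<in> ring_gen B\<close>
      by (simp add: M_def del: prod.lessThan_Suc)
  next
    case False
    then show ?thesis using M by (simp add: coeff_eq_0 gen_0)
  qed
  obtain k r where r: "g = M * k + r" "r = 0 \<or> degree r < degree M" "\<And>i. coeff r i \<in> ring_gen B"
    using division_by_monic[of M B g] M(1) Mcoeff g(2) by metis
  have "poly r (x j) = f" if j: "j \<le> n" for j
  proof -
    \<comment> \<open>A morphism realizing this transposition fixes f and the coefficients of r and
      moves x_n to x_j, so r has the same value at both points.\<close>
    let ?\<pi> = "transpose n j"
    have \<pi>: "?\<pi> permutes {..<Suc n}"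
      using j by (intro permutes_swap_id) auto
    obtain h where h: "ring_morphism h" "\<forall>a\<in>A. h a = a" "\<forall>i<Suc n. h (x i) = x (?\<pi> i)" "h f = f"
      using Suc.prems(2)[OF \<pi>] by blast
    interpret h: ring_morphism h by fact
    have "h (elem_sym (Suc n) x i) = elem_sym (Suc n) (\<lambda>a. x (?\<pi> a)) i" for i
      unfolding h.map_elem_sym by (rule elem_sym_cong) (use h(3) in simp)
    then have "h (elem_sym (Suc n) x i) = elem_sym (Suc n) x i" for i
      using elem_sym_permutes[OF \<pi>, of x i] by simp
    then have fixB: "h b = b" if "b \<in> ring_gen B" for b
      using h(2) by (rule_tac ring_morphism_fixes_ring_gen[OF h(1) that]) (auto simp: B_def)
    have "h (poly r (x n)) = (\<Sum>i\<le>degree r. coeff r i * x j ^ i)"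
      using h(3) by (simp add: poly_altdef h.map_sum h.map_mult h.map_power fixB r(3))
    moreover have "poly r (x n) = f"
      using g(1) r(1) Mroot[of n] by simp
    ultimately show ?thesis using h(4) by (simp add: poly_altdef)
  qed
  then have "r = [:f:]"
    using r(2) M(2) card_image[OF Suc.prems(1)]
    by (intro poly_eqI_degree[of "x ` {..<Suc n}"]) (auto simp: less_Suc_eq_le)
  then have "f = coeff r 0" by simp
  then show ?case using r(3)[of 0] by (simp add: B_def)
qed

section \<open>Algebraic independence of the elementary symmetric polynomials\<close>

lemma sum_digits_less:
  fixes N :: nat
  assumes "\<And>i. i < n \<Longrightarrow> f i < N"
  shows "(\<Sum>i<n. f i * N ^ i) < N ^ n"
  using assms
proof (induction n)
  case (Suc n)
  have "(\<Sum>i<Suc n. f i * N ^ i) < N ^ n + f n * N ^ n"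
    using Suc by simp
  also have "\<dots> = Suc (f n) * N ^ n" by simp
  also have "\<dots> \<le> N * N ^ n" using Suc.prems[of n] by (intro mult_right_mono) auto
  finally show ?case by simp
qed simp

lemma digits_unique:
  fixes N :: nat
  assumes "\<And>i. i < n \<Longrightarrow> f i < N" "\<And>i. i < n \<Longrightarrow> g i < N"
    and "(\<Sum>i<n. f i * N ^ i) = (\<Sum>i<n. g i * N ^ i)" "i < n"
  shows "f i = g i"
  using assms
proof (induction n)
  case (Suc n)
  have "N > 0" using Suc.prems(1)[of n] by simp
  have less: "(\<Sum>i<n. f i * N ^ i) < N ^ n" "(\<Sum>i<n. g i * N ^ i) < N ^ n"
    using Suc.prems by (auto intro: sum_digits_less)
  have eq: "(\<Sum>i<n. f i * N ^ i) + f n * N ^ n = (\<Sum>i<n. g i * N ^ i) + g n * N ^ n"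
    using Suc.prems(3) by simp
  have "((\<Sum>i<n. f i * N ^ i) + f n * N ^ n) div N ^ n = f n"
    using less(1) \<open>N > 0\<close> by (subst div_mult_self1) auto
  moreover have "((\<Sum>i<n. g i * N ^ i) + g n * N ^ n) div N ^ n = g n"
    using less(2) \<open>N > 0\<close> by (subst div_mult_self1) auto
  ultimately have "f n = g n" using eq by metis
  then show ?case using Suc eq by (cases "i = n") auto
qed simp

text \<open>Kronecker substitution \<open>X\<^sub>i \<mapsto> t^(N^i)\<close> reduces the multivariate case to one variable.\<close>

lemma int_mpoly_eq_0:
  fixes P :: "int mpoly"
  assumes "\<And>v :: nat \<Rightarrow> 'a::{idom,ring_char_0}. mp_eval of_int v P = 0"
  shows "P = 0"
proof (rule ccontr)
  assume "P \<noteq> 0"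
  then obtain m0 where m0: "m0 \<in> Poly_Mapping.keys P" by fastforce
  define U where "U = (\<Union>m\<in>Poly_Mapping.keys P. Poly_Mapping.keys m)"
  have "finite U" by (simp add: U_def)
  then obtain n where n: "U \<subseteq> {..<n}" by (meson finite_nat_iff_bounded)
  have vars: "Poly_Mapping.keys m \<subseteq> {..<n}" if "m \<in> Poly_Mapping.keys P" for m
    using that n by (auto simp: U_def)
  \<comment> \<open>\<open>N\<close> exceeds every exponent in \<open>P\<close>, so
    \<open>enc\<close> reads exponent vectors as base-N digits and is injective on the keys of
    \<open>P\<close>.\<close>
  define N where "N = Suc (\<Sum>m\<in>Poly_Mapping.keys P. \<Sum>i\<in>Poly_Mapping.keys m. Poly_Mapping.lookup m i)"
  have small: "Poly_Mapping.lookup m i < N" if "m \<in> Poly_Mapping.keys P" for m i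
  proof (cases "i \<in> Poly_Mapping.keys m")
    case True
    have "Poly_Mapping.lookup m i \<le> (\<Sum>i\<in>Poly_Mapping.keys m. Poly_Mapping.lookup m i)"
      using True by (intro member_le_sum) auto
    also have "\<dots> \<le> (\<Sum>m\<in>Poly_Mapping.keys P. \<Sum>i\<in>Poly_Mapping.keys m. Poly_Mapping.lookup m i)"
      using that by (intro member_le_sum[where f = "\<lambda>m. \<Sum>i\<in>Poly_Mapping.keys m. Poly_Mapping.lookup m i"]) auto
    finally show ?thesis by (simp add: N_def)
  qed (simp add: N_def in_keys_iff)
  define enc where "enc m = (\<Sum>i<n. Poly_Mapping.lookup m i * N ^ i)" for m :: "nat \<Rightarrow>\<^sub>0 nat"
  have inj: "m = k" if mk: "m \<in> Poly_Mapping.keys P" "k \<in> Poly_Mapping.keys P" "enc m = enc k" for m k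
  proof (rule poly_mapping_eqI)
    fix i
    show "Poly_Mapping.lookup m i = Poly_Mapping.lookup k i"
    proof (cases "i < n")
      case True
      show ?thesis
        by (rule digits_unique[OF _ _ mk(3)[unfolded enc_def] True]) (use small mk in auto)
    next
      case False
      then have "i \<notin> Poly_Mapping.keys m" "i \<notin> Poly_Mapping.keys k" using vars mk by auto
      then show ?thesis by (simp add: in_keys_iff)
    qed
  qed
  define p :: "'a poly" where "p = (\<Sum>m\<in>Poly_Mapping.keys P. monom (of_int (Poly_Mapping.lookup P m)) (enc m))"
  have "poly p t = 0" for t
  proof -
    have "mon_eval (\<lambda>i. t ^ N ^ i) m = t ^ enc m" if "m \<in> Poly_Mapping.keys P" for m
      by (simp add: mon_eval_superset[of "{..<n}" m] vars[OF that] enc_def power_sum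
          mult.commute flip: power_mult)
    then have "poly p t = mp_eval of_int (\<lambda>i. t ^ N ^ i) P"
      by (simp add: p_def poly_sum poly_monom mp_eval_mon)
    then show ?thesis using assms by simp
  qed
  then have "p = 0" using poly_all_0_iff_0 by blast
  then have "0 = coeff p (enc m0)" by simp
  also have "\<dots> = (\<Sum>m\<in>Poly_Mapping.keys P. if m = m0 then of_int (Poly_Mapping.lookup P m) else 0)"
    unfolding p_def coeff_sum coeff_monom
    by (rule sum.cong) (use inj m0 in auto)
  also have "\<dots> = of_int (Poly_Mapping.lookup P m0)"
    using m0 by (simp add: sum.delta)
  finally show False using m0 by (simp add: in_keys_iff)
qed

lemma monic_splits:
  fixes q :: "'a::alg_closed_field poly"
  assumes "lead_coeff q = 1"
  shows "\<exists>x. q = (\<Prod>a<degree q. [:x a, 1:])"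
  using assms
proof (induction "degree q" arbitrary: q)
  case 0
  then show ?case by (metis degree_eq_zeroE lead_coeff_pCons(2) lessThan_0 one_pCons prod.empty)
next
  case (Suc n)
  then obtain z where "poly q z = 0" using alg_closed_imp_poly_has_root[of q] by auto
  then obtain q' where q': "q = [:- z, 1:] * q'" by (auto simp: poly_eq_0_iff_dvd)
  have "q' \<noteq> 0" using Suc.hyps(2) q' by auto
  then have deg: "degree q = Suc (degree q')" unfolding q' by (subst degree_mult_eq) auto
  have "lead_coeff q' = 1" using Suc.prems unfolding q' by (subst (asm) lead_coeff_mult) simp
  then obtain x where x: "q' = (\<Prod>a<degree q'. [:x a, 1:])"
    using Suc.hyps(1)[of q'] Suc.hyps(2) deg by auto
  have "q = (\<Prod>a<degree q'. [:x a, 1:]) * [:- z, 1:]" using q' x by (metis mult.commute)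
  also have "(\<Prod>a<degree q'. [:x a, 1:]) = (\<Prod>a<degree q'. [:(x(degree q' := - z)) a, 1:])"
    by (intro prod.cong) auto
  finally have "q = (\<Prod>a<degree q. [:(x(degree q' := - z)) a, 1:])"
    unfolding deg prod.lessThan_Suc by simp
  then show ?case by blast
qed

text \<open>Over the complex numbers the elementary symmetric functions attain every point v: split
  the monic polynomial with coefficients v. A relation among them therefore vanishes
  everywhere.\<close>

lemma esym_independent:
  fixes P :: "int mpoly"
  assumes vars: "\<And>m. m \<in> Poly_Mapping.keys P \<Longrightarrow> Poly_Mapping.keys m \<subseteq> {1..n}"
    and zero: "mp_eval (\<lambda>c. mconst (of_int c)) (esym n) P = 0"
  shows "P = 0"
proof (rule int_mpoly_eq_0)
  fix v :: "nat \<Rightarrow> complex"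
  define q where "q = (\<Sum>i<n. monom (v (n - i)) i) + monom 1 n"
  have coeff_q: "coeff q j = (if j < n then v (n - j) else if j = n then 1 else 0)" for j
    by (auto simp: q_def coeff_sum coeff_monom sum.delta)
  then have "degree q = n"
    by (intro antisym degree_le le_degree) auto
  then obtain x where x: "q = (\<Prod>a<n. [:x a, 1:])"
    using monic_splits[of q] coeff_q by auto
  have vx: "v i = elem_sym n x i" if "i \<in> {1..n}" for i
    using that coeff_prod_linear[of i n x] coeff_q[of "n - i"] x by auto
  interpret E: ring_morphism "mp_eval (\<lambda>c. c) x"
    by (rule ring_morphism.ring_morphism_mp_eval[OF ring_morphism_id])
  have "mp_eval of_int v P = mp_eval of_int (elem_sym n x) P"
    using vars vx by (intro mp_eval_cong) blast
  also have "\<dots> = mp_eval (\<lambda>c. c) x (mp_eval (\<lambda>c. mconst (of_int c)) (esym n) P)"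
    by (simp add: E.map_mp_eval esym_eq_elem_sym E.map_elem_sym
        ring_morphism.mp_eval_mconst[OF ring_morphism_id] ring_morphism.mp_eval_mvar[OF ring_morphism_id])
  finally show "mp_eval of_int v P = 0" using zero by simp
qed

text \<open>Integral lifts are unique; this later identifies the lift provided by
  \<open>int_value\<close> with the one built from \<open>theta\<close>.\<close>

lemma int_mpoly_embed_inj:
  fixes P Q :: "int mpoly"
  assumes "mp_eval (\<lambda>c. mconst (of_int c :: complex)) mvar P = mp_eval (\<lambda>c. mconst (of_int c)) mvar Q"
  shows "P = Q"
proof -
  interpret C: ring_morphism "mp_eval (\<lambda>c. mconst (of_int c :: complex)) mvar :: int mpoly \<Rightarrow> _"
    by (rule ring_morphism.ring_morphism_mp_eval[OF ring_morphism_mconst_of_int])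
  have "P - Q = 0"
  proof (rule int_mpoly_eq_0)
    fix v :: "nat \<Rightarrow> complex"
    interpret E: ring_morphism "mp_eval (\<lambda>c. c) v"
      by (rule ring_morphism.ring_morphism_mp_eval[OF ring_morphism_id])
    have "mp_eval of_int v (P - Q) = mp_eval (\<lambda>c. c) v (mp_eval (\<lambda>c. mconst (of_int c)) mvar (P - Q))"
      by (simp add: E.map_mp_eval ring_morphism.mp_eval_mconst[OF ring_morphism_id]
          ring_morphism.mp_eval_mvar[OF ring_morphism_id])
    then show "mp_eval of_int v (P - Q) = 0" using assms by (simp add: C.map_diff)
  qed
  then show ?thesis by simp
qed

section \<open>Cyclotomic polynomials\<close>

definition primitive_root :: "nat \<Rightarrow> 'a::field \<Rightarrow> bool" where
  "primitive_root l z \<longleftrightarrow> l > 0 \<and> z ^ l = 1 \<and> (\<forall>k. 0 < k \<and> k < l \<longrightarrow> z ^ k \<noteq> 1)"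

definition unit_residues :: "nat \<Rightarrow> nat set" where
  "unit_residues l = {i. i < l \<and> coprime i l}"

lemma finite_unit_residues [simp]: "finite (unit_residues l)"
  by (simp add: unit_residues_def)

lemma primitive_root_nz: "primitive_root l z \<Longrightarrow> z \<noteq> 0"
  by (auto simp: primitive_root_def power_0_left)

lemma primitive_root_eps:
  assumes "l > 0"
  shows "primitive_root l (eps l)"
proof -
  have pow: "eps l ^ k = cis (2 * pi * real k / real l)" for k
    by (simp add: eps_def DeMoivre mult_ac)
  have inj: "inj_on (\<lambda>k. cis (2 * pi * real k / real l)) {..<l}"
    using bij_betw_roots_unity[OF assms] by (rule bij_betw_imp_inj_on)
  have "eps l ^ k \<noteq> 1" if "0 < k" "k < l" for k
    using inj_onD[OF inj, of k 0] that by (auto simp: pow)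
  moreover have "eps l ^ l = 1" using assms by (simp add: pow)
  ultimately show ?thesis using assms by (simp add: primitive_root_def)
qed

lemma primitive_root_inj:
  assumes "primitive_root l z"
  shows "inj_on (\<lambda>i. z ^ i) {..<l}"
proof (rule linorder_inj_onI)
  fix i j :: nat assume ij: "i < j" "i \<in> {..<l}" "j \<in> {..<l}"
  have "z ^ j = z ^ i * z ^ (j - i)" using ij by (simp flip: power_add)
  moreover have "z ^ (j - i) \<noteq> 1" using assms ij by (auto simp: primitive_root_def)
  ultimately show "z ^ i \<noteq> z ^ j" using primitive_root_nz[OF assms] by simp
qed auto

lemma primitive_root_power_div:
  assumes "primitive_root l z" "d dvd l"
  shows "primitive_root d (z ^ (l div d))"
proof -
  from assms(2) obtain c where c: "l = d * c" by blast
  have pos: "d > 0" "c > 0" using assms(1) c by (auto simp: primitive_root_def)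
  have "z ^ (c * k) \<noteq> 1" if "0 < k" "k < d" for k
    using assms(1) that pos unfolding primitive_root_def c by (auto simp: mult.commute)
  then show ?thesis
    using assms(1) pos by (auto simp: primitive_root_def c mult.commute simp flip: power_mult)
qed

lemma primitive_root_prod:
  fixes z :: "'a::field"
  assumes "primitive_root l z"
  shows "monom 1 l - 1 = (\<Prod>i<l. [:- (z ^ i), 1:])"
proof (rule poly_eqI_degree_lead_coeff[where n = l and A = "(\<lambda>i. z ^ i) ` {..<l}"])
  have l: "l > 0" using assms by (simp add: primitive_root_def)
  show "coeff (monom 1 l - 1) l = coeff (\<Prod>i<l. [:- (z ^ i), 1:]) l"
    using l lead_coeff_prod_linear[of "\<lambda>i. - (z ^ i)" "{..<l}"] by (simp add: degree_prod_linear)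
  show "l \<le> card ((\<lambda>i. z ^ i) ` {..<l})"
    by (simp add: card_image[OF primitive_root_inj[OF assms]])
  show "degree (monom 1 l - 1 :: 'a poly) \<le> l"
    by (intro degree_diff_le) (auto simp: degree_monom_le)
  show "degree (\<Prod>i<l. [:- (z ^ i), 1:]) \<le> l"
    by (simp add: degree_prod_linear)
  fix y assume "y \<in> (\<lambda>i. z ^ i) ` {..<l}"
  then obtain i where i: "i < l" "y = z ^ i" by auto
  have "y ^ l = (z ^ l) ^ i" by (simp add: i mult.commute flip: power_mult)
  then have "y ^ l = 1" using assms by (simp add: primitive_root_def)
  then show "poly (monom 1 l - 1) y = poly (\<Prod>i<l. [:- (z ^ i), 1:]) y"
    using i by (auto simp: poly_monom poly_prod prod_zero_iff)
qed

text \<open>Sorts i < l by g = gcd i l, writing i = g * i' with i' prime to d = l/g. The index 0 has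
  gcd l and lands at d = 1, where \<open>unit_residues 1\<close> is {0}.\<close>

lemma prod_divisors_unit_residues:
  assumes "l > 0"
  shows "(\<Prod>i<l. g i) = (\<Prod>d\<in>{d. d dvd l}. \<Prod>i\<in>unit_residues d. g (l div d * i))"
proof -
  have "(\<Prod>i<l. g i) = (\<Prod>(d, i)\<in>Sigma {d. d dvd l} unit_residues. g (l div d * i))"
  proof (rule prod.reindex_bij_witness[where j = "\<lambda>i. (l div gcd i l, i div gcd i l)"
        and i = "\<lambda>(d, i). l div d * i"], goal_cases)
    case (1 i)
    then show ?case using assms by (auto simp: div_div_eq_right)
  next
    case (2 i)
    then show ?case using assms
      by (auto simp: unit_residues_def div_dvd_iff_mult div_gcd_coprime div_less_mono)
  next
    case (3 di)
    then obtain d i c where *: "di = (d, i)" "l = d * c" "i < d" "coprime i d" by (auto simp: unit_residues_def)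
    then have "gcd (c * i) (d * c) = c"
      using gcd_mult_distrib_nat[of c i d] by (simp add: mult.commute)
    then show ?case using * assms by auto
  next
    case (4 di)
    then obtain d i c where *: "di = (d, i)" "l = d * c" "i < d" by (auto simp: unit_residues_def)
    then show ?case using assms by (auto simp: mult.commute)
  next
    case (5 i)
    then show ?case using assms by (auto simp: div_div_eq_right)
  qed
  then show ?thesis using assms by (subst prod.Sigma) auto
qed

lemma primitive_root_prod_divisors:
  fixes z :: "'a::field"
  assumes "primitive_root l z"
  shows "monom 1 l - 1 = (\<Prod>d\<in>{d. d dvd l \<and> d < l}. \<Prod>i\<in>unit_residues d. [:- ((z ^ (l div d)) ^ i), 1:]) *
    (\<Prod>i\<in>unit_residues l. [:- (z ^ i), 1:])"
proof -
  have l: "l > 0" using assms by (simp add: primitive_root_def)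
  then have "{d. d dvd l} = insert l {d. d dvd l \<and> d < l}" by (auto dest: dvd_imp_le)
  moreover have "finite {d. d dvd l \<and> d < l}" by auto
  ultimately show ?thesis
    using l unfolding primitive_root_prod[OF assms] prod_divisors_unit_residues[OF l, of "\<lambda>i. [:- (z ^ i), 1:]"]
    by (simp add: power_mult)
qed

text \<open>Induction over proper divisors: the wanted polynomial is the quotient of X^l - 1 by the
  monic product D of the earlier ones. Characteristic 0 on the side of z makes this division exact
  over the integers, and the resulting identity maps to the field of w in any
  characteristic.\<close>

lemma cyclotomic_int_poly:
  fixes z :: "'a::field_char_0" and w :: "'b::field"
  assumes "primitive_root l z" "primitive_root l w"
  shows "\<exists>C :: int poly. map_poly of_int C = (\<Prod>i\<in>unit_residues l. [:- (z ^ i), 1:]) \<and>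
    map_poly of_int C = (\<Prod>i\<in>unit_residues l. [:- (w ^ i), 1:])"
  using assms
proof (induction l arbitrary: z w rule: less_induct)
  case (less l)
  interpret A: ring_morphism "of_int :: int \<Rightarrow> 'a" by (rule ring_morphism_of_int)
  interpret B: ring_morphism "of_int :: int \<Rightarrow> 'b" by (rule ring_morphism_of_int)
  have "\<exists>C :: int poly. map_poly of_int C = (\<Prod>i\<in>unit_residues d. [:- ((z ^ (l div d)) ^ i), 1:]) \<and>
    map_poly of_int C = (\<Prod>i\<in>unit_residues d. [:- ((w ^ (l div d)) ^ i), 1:])" if "d dvd l" "d < l" for d
    using less.IH[OF that(2)] less.prems that(1) by (simp add: primitive_root_power_div)
  then obtain C :: "nat \<Rightarrow> int poly" where
    Cz: "\<And>d. d dvd l \<Longrightarrow> d < l \<Longrightarrow> map_poly of_int (C d) = (\<Prod>i\<in>unit_residues d. [:- ((z ^ (l div d)) ^ i), 1:])" and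
    Cw: "\<And>d. d dvd l \<Longrightarrow> d < l \<Longrightarrow> map_poly of_int (C d) = (\<Prod>i\<in>unit_residues d. [:- ((w ^ (l div d)) ^ i), 1:])"
    by metis
  define D where "D = (\<Prod>d\<in>{d. d dvd l \<and> d < l}. C d)"
  define Dz where "Dz = (map_poly of_int D :: 'a poly)"
  define Dw where "Dw = (map_poly of_int D :: 'b poly)"
  have Dz: "Dz = (\<Prod>d\<in>{d. d dvd l \<and> d < l}. \<Prod>i\<in>unit_residues d. [:- ((z ^ (l div d)) ^ i), 1:])"
    by (simp add: Dz_def D_def A.map_poly_prod Cz)
  have Dw: "Dw = (\<Prod>d\<in>{d. d dvd l \<and> d < l}. \<Prod>i\<in>unit_residues d. [:- ((w ^ (l div d)) ^ i), 1:])"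
    by (simp add: Dw_def D_def B.map_poly_prod Cw)
  have nz: "Dz \<noteq> 0" "Dw \<noteq> 0" unfolding Dz Dw by (auto simp: prod_zero_iff)
  have degz: "degree Dz = degree D" unfolding Dz_def by (rule degree_map_poly) simp
  have "lead_coeff Dz = 1"
    unfolding Dz by (simp add: lead_coeff_prod)
  \<comment> \<open>As \<open>of_int\<close> is injective into the field of z, monicity descends to
    the integers.\<close>
  then have "of_int (lead_coeff D) = (1 :: 'a)" by (simp add: degz) (simp add: Dz_def coeff_map_poly)
  then have "lead_coeff D = 1" by simp
  moreover have "a \<in> ring_gen UNIV" for a :: int by (auto intro: gen_base)
  ultimately obtain k r where r: "monom 1 l - 1 = D * k + r" "r = 0 \<or> degree r < degree D"
    using division_by_monic[of D UNIV "monom 1 l - 1"] by metis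
  let ?P = "\<Prod>i\<in>unit_residues l. [:- (z ^ i), 1:]"
  have "(monom 1 l - 1 :: 'a poly) = Dz * map_poly of_int k + map_poly of_int r"
    using arg_cong[OF r(1), of "map_poly of_int :: int poly \<Rightarrow> 'a poly"]
    by (simp only: A.map_poly_monom_diff_1 A.map_poly_mult A.map_poly_add Dz_def)
  then have "Dz * ?P = Dz * map_poly of_int k + map_poly of_int r"
    using primitive_root_prod_divisors[OF less.prems(1)] by (simp add: Dz)
  then have diff: "Dz * (?P - map_poly of_int k) = map_poly of_int r" by (simp add: algebra_simps)
  \<comment> \<open>Over the field of z, D divides the image of r, which would have smaller
    degree.\<close>
  have "r = 0"
  proof (rule ccontr)
    assume "r \<noteq> 0"
    then have small: "degree r < degree D" using r(2) by simp
    have deg: "degree (map_poly of_int r :: 'a poly) = degree r" by (rule degree_map_poly) simp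
    have "coeff (map_poly of_int r :: 'a poly) (degree r) \<noteq> 0"
      using \<open>r \<noteq> 0\<close> by (simp add: coeff_map_poly)
    then have "?P - map_poly of_int k \<noteq> 0"
      using diff by (metis coeff_0 mult_zero_right)
    from degree_mult_eq[OF nz(1) this] show False
      using small degz deg unfolding diff by linarith
  qed
  then have "map_poly of_int k = ?P" using diff nz(1) by simp
  moreover have "(monom 1 l - 1 :: 'b poly) = Dw * map_poly of_int k"
    using arg_cong[OF r(1), of "map_poly of_int :: int poly \<Rightarrow> 'b poly"] \<open>r = 0\<close>
    by (simp only: B.map_poly_monom_diff_1 B.map_poly_mult Dw_def add_0_right)
  then have "Dw * map_poly of_int k = Dw * (\<Prod>i\<in>unit_residues l. [:- (w ^ i), 1:])"
    using primitive_root_prod_divisors[OF less.prems(2)] by (simp add: Dw)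
  then have "map_poly of_int k = (\<Prod>i\<in>unit_residues l. [:- (w ^ i), 1:])" using nz(2) by simp
  ultimately show ?case by blast
qed

section \<open>Norm forms\<close>

text \<open>A subring of the product of two rings, written as a relation: a partial substitute for a
  ring morphism from \<open>'s\<close> to \<open>'t\<close>.\<close>

locale subring_rel =
  fixes R :: "'s::comm_ring_1 \<Rightarrow> 't::comm_ring_1 \<Rightarrow> bool"
  assumes rel_1: "R 1 1"
    and rel_diff: "R a a' \<Longrightarrow> R b b' \<Longrightarrow> R (a - b) (a' - b')"
    and rel_mult: "R a a' \<Longrightarrow> R b b' \<Longrightarrow> R (a * b) (a' * b')"
begin

lemma rel_0: "R 0 0"
  using rel_diff[OF rel_1 rel_1] by simp

lemma rel_uminus: "R a a' \<Longrightarrow> R (- a) (- a')"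
  using rel_diff[OF rel_0] by simp

lemma rel_add: "R a a' \<Longrightarrow> R b b' \<Longrightarrow> R (a + b) (a' + b')"
  using rel_diff[OF _ rel_uminus] by simp

lemma rel_of_nat: "R (of_nat k) (of_nat k)"
  by (induction k) (auto intro: rel_0 rel_add rel_1)

lemma rel_of_int: "R (of_int k) (of_int k)"
  by (cases k) (auto intro: rel_of_nat rel_diff rel_uminus rel_1 simp del: of_nat_Suc)

lemma rel_sum: "(\<And>i. i \<in> I \<Longrightarrow> R (g i) (g' i)) \<Longrightarrow> R (\<Sum>i\<in>I. g i) (\<Sum>i\<in>I. g' i)"
  by (induction I rule: infinite_finite_induct) (auto intro: rel_0 rel_add)

lemma rel_prod: "(\<And>i. i \<in> I \<Longrightarrow> R (g i) (g' i)) \<Longrightarrow> R (\<Prod>i\<in>I. g i) (\<Prod>i\<in>I. g' i)"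
  by (induction I rule: infinite_finite_induct) (auto intro: rel_1 rel_mult)

text \<open>The remaining factors must have some partner, for only then does the relation extend to
  the whole product.\<close>

lemma rel_prod_0:
  assumes "finite I" "i \<in> I" "R (g i) 0" "\<And>j. j \<in> I \<Longrightarrow> \<exists>b. R (g j) b"
  shows "R (\<Prod>j\<in>I. g j) 0"
proof -
  from assms(4) obtain b where b: "\<And>j. j \<in> I \<Longrightarrow> R (g j) (b j)" by metis
  have "R (g i * (\<Prod>j\<in>I - {i}. g j)) (0 * (\<Prod>j\<in>I - {i}. b j))"
    using b assms(3) by (intro rel_mult rel_prod) auto
  then show ?thesis using prod.remove[OF assms(1,2), of g] by simp
qed

end

text \<open>Vieta again; the right-hand side does not mention z, so two roots of unity sharing
  \<open>C\<close> give the same integers.\<close>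

lemma elem_sym_primitive_roots:
  fixes z :: "'a::field"
  assumes "bij_betw u {..<k} (unit_residues l)" "k = card (unit_residues l)"
    and "map_poly of_int C = (\<Prod>i\<in>unit_residues l. [:- (z ^ i), 1:])" "i \<le> k"
  shows "elem_sym k (\<lambda>a. z ^ u a) i = of_int ((- 1) ^ i * coeff C (k - i))"
proof -
  have "of_int (coeff C (k - i)) = coeff (map_poly of_int C :: 'a poly) (k - i)"
    by (simp add: coeff_map_poly)
  also have "\<dots> = coeff (\<Prod>a<k. [:- (z ^ u a), 1:]) (k - i)"
    unfolding assms(3) using prod.reindex_bij_betw[OF assms(1), of "\<lambda>i. [:- (z ^ i), 1:]"] by simp
  also have "\<dots> = (- 1) ^ i * elem_sym k (\<lambda>a. z ^ u a) i"
    by (simp add: coeff_prod_linear[OF assms(4)] elem_sym_uminus)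
  finally have "of_int ((- 1) ^ i * coeff C (k - i)) = ((- 1) * (- 1)) ^ i * elem_sym k (\<lambda>a. z ^ u a) i"
    by (simp add: mult.assoc[symmetric] power_mult_distrib[symmetric] del: mult_minus1_right mult_minus1)
  then show ?thesis by simp
qed

text \<open>Both norm forms are the image of the same element of \<open>\<int>[Z, X]\<close>, symmetric in
  the variables \<open>Z\<close> that stand for the primitive roots of unity. It is therefore a polynomial in the
  elementary symmetric functions of these roots, which are the same integers on both sides.\<close>

theorem (in subring_rel) rel_norm_form:
  fixes z :: "'a::field_char_0" and w :: "'b::field"
    and \<kappa> :: "'a \<Rightarrow> 's" and \<kappa>' :: "'b \<Rightarrow> 't"
  assumes z: "primitive_root l z" and w: "primitive_root l w"
    and \<kappa>: "ring_morphism \<kappa>" and \<kappa>': "ring_morphism \<kappa>'"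
    and g: "\<And>j. j < l \<Longrightarrow> R (g j) (y j)"
  shows "R (\<Prod>i\<in>unit_residues l. \<Sum>j<l. \<kappa> (z ^ (i * j)) * g j)
    (\<Prod>i\<in>unit_residues l. \<Sum>j<l. \<kappa>' (w ^ (i * j)) * y j)"
proof -
  interpret \<kappa>: ring_morphism \<kappa> by fact
  interpret \<kappa>': ring_morphism \<kappa>' by fact
  define k where "k = card (unit_residues l)"
  obtain u where u: "bij_betw u {..<k} (unit_residues l)"
    using ex_bij_betw_nat_finite[of "unit_residues l"] by (auto simp: k_def atLeast0LessThan)
  obtain C :: "int poly" where
    Cz: "map_poly of_int C = (\<Prod>i\<in>unit_residues l. [:- (z ^ i), 1:])" and
    Cw: "map_poly of_int C = (\<Prod>i\<in>unit_residues l. [:- (w ^ i), 1:])"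
    using cyclotomic_int_poly[OF z w] by blast
  \<comment> \<open>Variables below k stand for the primitive roots, variable k + j for X_j; the
    latter form the coefficient set \<open>A\<close>.\<close>
  define G :: "int mpoly" where "G = (\<Prod>a<k. \<Sum>j<l. mvar a ^ j * mvar (k + j))"
  define A :: "int mpoly set" where "A = (\<lambda>j. mvar (k + j)) ` {..<l}"
  have G: "G \<in> ring_gen (A \<union> elem_sym k mvar ` {1..k})"
  proof (rule symmetric_in_ring_gen_elem_sym)
    show "inj_on (mvar :: nat \<Rightarrow> int mpoly) {..<k}" by (auto simp: inj_on_def)
    show "G \<in> ring_gen (A \<union> mvar ` {..<k})"
      unfolding G_def A_def by (intro gen_prod gen_sum gen_mult gen_power gen_base) auto
    fix \<pi> assume \<pi>: "\<pi> permutes {..<k}"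
    define h where "h = (mp_subst (\<lambda>v. mvar (\<pi> v)) :: int mpoly \<Rightarrow> int mpoly)"
    interpret h: ring_morphism h unfolding h_def by (rule ring_morphism_mp_subst)
    have hv: "h (mvar v) = mvar (\<pi> v)" for v by (simp add: h_def)
    have stay: "\<pi> (k + j) = k + j" for j using \<pi> by (simp add: permutes_def)
    have "h G = (\<Prod>a<k. \<Sum>j<l. mvar (\<pi> a) ^ j * mvar (k + j))"
      by (simp add: G_def h.map_prod h.map_sum h.map_mult h.map_power hv stay)
    also have "\<dots> = G"
      unfolding G_def by (rule prod.reindex_bij_betw[OF permutes_imp_bij[OF \<pi>]])
    finally show "\<exists>h. ring_morphism h \<and> (\<forall>a\<in>A. h a = a) \<and> (\<forall>i<k. h (mvar i) = mvar (\<pi> i)) \<and> h G = G"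
      using h.ring_morphism_axioms hv stay by (intro exI[of _ h]) (auto simp: A_def)
  qed
  \<comment> \<open>Two specializations of the same G: the root variables go to powers of z or of w,
    and X_j to the related elements g j and y j.\<close>
  define \<alpha> where "\<alpha> = (mp_eval of_int (\<lambda>v. if v < k then \<kappa> (z ^ u v) else g (v - k)) :: int mpoly \<Rightarrow> 's)"
  define \<beta> where "\<beta> = (mp_eval of_int (\<lambda>v. if v < k then \<kappa>' (w ^ u v) else y (v - k)) :: int mpoly \<Rightarrow> 't)"
  interpret \<alpha>: ring_morphism \<alpha>
    unfolding \<alpha>_def by (rule ring_morphism.ring_morphism_mp_eval[OF ring_morphism_of_int])
  interpret \<beta>: ring_morphism \<beta>
    unfolding \<beta>_def by (rule ring_morphism.ring_morphism_mp_eval[OF ring_morphism_of_int])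
  have \<alpha>v: "\<alpha> (mvar v) = (if v < k then \<kappa> (z ^ u v) else g (v - k))" for v
    by (simp add: \<alpha>_def ring_morphism.mp_eval_mvar[OF ring_morphism_of_int])
  have \<beta>v: "\<beta> (mvar v) = (if v < k then \<kappa>' (w ^ u v) else y (v - k))" for v
    by (simp add: \<beta>_def ring_morphism.mp_eval_mvar[OF ring_morphism_of_int])
  \<comment> \<open>Nothing relates the individual roots of unity on the two sides; only the
    symmetrized generators are related, and these suffice to build G.\<close>
  have "R (\<alpha> G) (\<beta> G)"
    using G
  proof induction
    case (gen_base a)
    then consider j where "j < l" "a = mvar (k + j)" | i where "i \<le> k" "a = elem_sym k mvar i"
      by (auto simp: A_def)
    then show ?case
    proof cases
      case 1
      then show ?thesis using g by (simp add: \<alpha>v \<beta>v)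
    next
      case 2
      have "\<alpha> a = elem_sym k (\<lambda>a. \<kappa> (z ^ u a)) i"
        unfolding 2(2) \<alpha>.map_elem_sym by (rule elem_sym_cong) (simp add: \<alpha>v)
      also have "\<dots> = of_int ((- 1) ^ i * coeff C (k - i))"
        unfolding \<kappa>.map_elem_sym[symmetric] elem_sym_primitive_roots[OF u k_def Cz 2(1)] by (rule \<kappa>.map_of_int)
      finally have 1: "\<alpha> a = of_int ((- 1) ^ i * coeff C (k - i))" .
      have "\<beta> a = elem_sym k (\<lambda>a. \<kappa>' (w ^ u a)) i"
        unfolding 2(2) \<beta>.map_elem_sym by (rule elem_sym_cong) (simp add: \<beta>v)
      also have "\<dots> = of_int ((- 1) ^ i * coeff C (k - i))"
        unfolding \<kappa>'.map_elem_sym[symmetric] elem_sym_primitive_roots[OF u k_def Cw 2(1)] by (rule \<kappa>'.map_of_int)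
      finally have 3: "\<beta> a = of_int ((- 1) ^ i * coeff C (k - i))" .
      show ?thesis unfolding 1 3 by (rule rel_of_int)
    qed
  next
    case gen_1
    show ?case by (simp add: rel_1)
  next
    case (gen_diff a b)
    then show ?case by (simp add: \<alpha>.map_diff \<beta>.map_diff rel_diff)
  next
    case (gen_mult a b)
    then show ?case by (simp add: \<alpha>.map_mult \<beta>.map_mult rel_mult)
  qed
  moreover have "\<alpha> G = (\<Prod>i\<in>unit_residues l. \<Sum>j<l. \<kappa> (z ^ (i * j)) * g j)"
    by (simp add: G_def \<alpha>.map_prod \<alpha>.map_sum \<alpha>.map_mult \<alpha>.map_power \<alpha>v power_mult \<kappa>.map_power
        prod.reindex_bij_betw[OF u, of "\<lambda>i. \<Sum>j<l. (\<kappa> z ^ i) ^ j * g j"])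
  moreover have "\<beta> G = (\<Prod>i\<in>unit_residues l. \<Sum>j<l. \<kappa>' (w ^ (i * j)) * y j)"
    by (simp add: G_def \<beta>.map_prod \<beta>.map_sum \<beta>.map_mult \<beta>.map_power \<beta>v power_mult \<kappa>'.map_power
        prod.reindex_bij_betw[OF u, of "\<lambda>i. \<Sum>j<l. (\<kappa>' w ^ i) ^ j * y j"])
  ultimately show ?thesis by simp
qed

section \<open>The symmetric polynomials \<open>\<Theta>\<close>\<close>

text \<open>At rational constants v j this is the norm to Q of the sum of eps^j v_j in the l-th
  cyclotomic field.\<close>

definition norm_form :: "nat \<Rightarrow> (nat \<Rightarrow> complex mpoly) \<Rightarrow> complex mpoly" where
  "norm_form l v = (\<Prod>i\<in>unit_residues l. \<Sum>j<l. mconst (eps l ^ (i * j)) * v j)"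

lemma mp_subst_Psi: "mp_subst v (Psi l) = norm_form l v"
proof -
  interpret ring_morphism "mp_subst v" by (rule ring_morphism_mp_subst)
  show ?thesis
    by (simp add: Psi_def norm_form_def unit_residues_def map_prod map_sum map_mult)
qed

lemma mp_subst_perm_act: "mp_subst v (perm_act \<sigma> P) = mp_subst (\<lambda>j. v (\<sigma> j)) P"
  by (simp add: perm_act_def mp_subst_subst)

lemma perm_act_perm_act: "perm_act \<tau> (perm_act \<sigma> P) = perm_act (\<lambda>j. \<tau> (\<sigma> j)) P"
  by (simp add: perm_act_def mp_subst_subst)

definition Psi_orbit :: "nat \<Rightarrow> complex mpoly set" where
  "Psi_orbit l = {perm_act \<sigma> (Psi l) | \<sigma>. \<sigma> permutes {..<l}}"

lemma finite_Psi_orbit: "finite (Psi_orbit l)"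
proof -
  have "Psi_orbit l = (\<lambda>\<sigma>. perm_act \<sigma> (Psi l)) ` {\<sigma>. \<sigma> permutes {..<l}}"
    by (auto simp: Psi_orbit_def)
  then show ?thesis by (simp add: finite_permutations)
qed

text \<open>Every member of the orbit is a substitution instance of \<open>Psi l\<close>, so the
  inverse laws reduce to composing index maps.\<close>

lemma perm_act_Psi_orbit:
  assumes "\<tau> permutes {..<l}" "P \<in> Psi_orbit l"
  shows "perm_act \<tau> P \<in> Psi_orbit l" "perm_act (inv_into UNIV \<tau>) (perm_act \<tau> P) = P"
    "perm_act \<tau> (perm_act (inv_into UNIV \<tau>) P) = P"
proof -
  from assms(2) obtain \<sigma> where \<sigma>: "P = perm_act \<sigma> (Psi l)" "\<sigma> permutes {..<l}"
    by (auto simp: Psi_orbit_def)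
  have "(\<lambda>j. \<tau> (\<sigma> j)) permutes {..<l}"
    using permutes_compose[OF \<sigma>(2) assms(1)] by (simp add: comp_def)
  then show "perm_act \<tau> P \<in> Psi_orbit l"
    unfolding \<sigma> perm_act_perm_act Psi_orbit_def by blast
  show "perm_act (inv_into UNIV \<tau>) (perm_act \<tau> P) = P" "perm_act \<tau> (perm_act (inv_into UNIV \<tau>) P) = P"
    by (simp_all add: \<sigma> perm_act_perm_act permutes_inverses[OF assms(1)])
qed

text \<open>Distinct members of the orbit may coincide after substitution, so the product stays
  indexed by the orbit and not by the images.\<close>

lemma mp_subst_Phi: "mp_subst v (Phi l) = (\<Prod>F\<in>Psi_orbit l. mp_subst v F)"
  unfolding Phi_def Psi_orbit_def by (rule ring_morphism.map_prod[OF ring_morphism_mp_subst])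

lemma mp_subst_Phi_permutes:
  assumes "\<tau> permutes {..<l}"
  shows "mp_subst (\<lambda>j. v (\<tau> j)) (Phi l) = mp_subst v (Phi l)"
proof -
  have "mp_subst (\<lambda>j. v (\<tau> j)) (Phi l) = (\<Prod>F\<in>Psi_orbit l. mp_subst v (perm_act \<tau> F))"
    unfolding mp_subst_Phi mp_subst_perm_act ..
  also have "\<dots> = (\<Prod>F\<in>Psi_orbit l. mp_subst v F)"
    using perm_act_Psi_orbit[OF assms] perm_act_Psi_orbit[OF permutes_inv[OF assms]]
    by (intro prod.reindex_bij_witness[where i = "perm_act (inv_into UNIV \<tau>)" and j = "perm_act \<tau>"]) auto
  finally show ?thesis by (simp add: mp_subst_Phi)
qed

definition block_sums :: "nat \<Rightarrow> (nat \<Rightarrow> nat set) \<Rightarrow> nat \<Rightarrow> complex mpoly" where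
  "block_sums l P j = (if j < l then \<Sum>a\<in>P j. mvar a else 0)"

text \<open>\<open>part_enum\<close> picks an arbitrary numbering of the blocks; the symmetry of
  \<open>Phi\<close> makes the choice immaterial.\<close>

lemma Phi_block_sums_cong:
  assumes P: "bij_betw P {..<l} Q" and P': "bij_betw P' {..<l} Q"
  shows "mp_subst (block_sums l P) (Phi l) = mp_subst (block_sums l P') (Phi l)"
proof -
  \<comment> \<open>The change of numbering, extended by the identity to a permutation.\<close>
  define \<tau> where "\<tau> j = (if j \<in> {..<l} then inv_into {..<l} P (P' j) else j)" for j
  have "bij_betw (\<lambda>j. inv_into {..<l} P (P' j)) {..<l} {..<l}"
    using bij_betw_trans[OF P' bij_betw_inv_into[OF P]] by (simp add: comp_def)
  then have "bij_betw \<tau> {..<l} {..<l}"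
    by (subst bij_betw_cong[where g = "\<lambda>j. inv_into {..<l} P (P' j)"]) (auto simp: \<tau>_def)
  then have \<tau>: "\<tau> permutes {..<l}"
    by (rule bij_imp_permutes) (simp add: \<tau>_def)
  have "P (\<tau> j) = P' j" if "j < l" for j
    using that P P' by (auto simp: \<tau>_def bij_betw_def intro!: f_inv_into_f)
  moreover have "\<tau> j < l \<longleftrightarrow> j < l" for j
    using permutes_in_image[OF \<tau>, of j] by simp
  ultimately have "block_sums l P' = (\<lambda>j. block_sums l P (\<tau> j))"
    by (auto simp: block_sums_def fun_eq_iff)
  then show ?thesis using mp_subst_Phi_permutes[OF \<tau>, of "block_sums l P"] by simp
qed

section \<open>Partitions and the symmetry of Theta\<close>

lemma finite_part_set: "finite (part_set n l)"
proof (rule finite_subset)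
  show "part_set n l \<subseteq> Pow (Pow {..<n})"
    by (auto simp: part_set_def dest: partition_onD1)
qed simp

lemma part_enum_bij:
  assumes "Q \<in> part_set n l"
  shows "bij_betw (part_enum l Q) {..<l} Q"
proof -
  have "partition_on {..<n} Q" "card Q = l" using assms by (auto simp: part_set_def)
  moreover then have "finite Q"
    by (intro finite_elements[of "{..<n}"]) auto
  ultimately have "\<exists>P. bij_betw P {..<l} Q"
    using ex_bij_betw_nat_finite[of Q] by (auto simp: atLeast0LessThan)
  then show ?thesis unfolding part_enum_def by (rule someI_ex)
qed

lemma part_set_permutes:
  assumes \<pi>: "\<pi> permutes {..<n}" and Q: "Q \<in> part_set n l"
  shows "image \<pi> ` Q \<in> part_set n l"
proof -
  have Q': "partition_on {..<n} Q" "card Q = l" "\<forall>B\<in>Q. card B = n div l"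
    using Q by (auto simp: part_set_def)
  have inj: "inj \<pi>" using \<pi> by (rule permutes_inj)
  have "partition_on (\<pi> ` {..<n}) (image \<pi> ` Q - {{}})"
    using Q'(1) inj by (intro partition_on_inj_image) (auto intro: inj_on_subset)
  moreover have "{} \<notin> image \<pi> ` Q" using partition_onD3[OF Q'(1)] by auto
  ultimately have "partition_on {..<n} (image \<pi> ` Q)"
    by (simp add: permutes_image[OF \<pi>])
  moreover have "card (image \<pi> ` Q) = l"
    using Q'(2) inj by (subst card_image) (auto simp: inj_on_def inj_image_eq_iff)
  moreover have "\<forall>B\<in>image \<pi> ` Q. card B = n div l"
    using Q'(3) by (auto simp: card_image[OF inj_on_subset[OF inj subset_UNIV]])
  ultimately show ?thesis by (simp add: part_set_def)
qed

lemma Theta_block_sums: "Theta n l = (\<Prod>Q\<in>part_set n l. mp_subst (block_sums l (part_enum l Q)) (Phi l))"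
  by (simp add: Theta_def block_sums_def [abs_def])

text \<open>Permuting variables permutes the partitions. The numbering carried over from Q may
  differ from the one chosen for its image, which \<open>Phi_block_sums_cong\<close>
  absorbs.\<close>

lemma perm_act_Theta:
  assumes \<pi>: "\<pi> permutes {..<n}"
  shows "perm_act \<pi> (Theta n l) = Theta n l"
proof -
  interpret \<pi>: ring_morphism "perm_act \<pi>"
    unfolding perm_act_def [abs_def] by (rule ring_morphism_mp_subst)
  let ?S = "\<lambda>Q. mp_subst (block_sums l (part_enum l Q)) (Phi l)"
  have inj: "inj \<pi>" using \<pi> by (rule permutes_inj)
  have step: "perm_act \<pi> (?S Q) = ?S (image \<pi> ` Q)" if Q: "Q \<in> part_set n l" for Q
  proof -
    let ?P = "part_enum l Q"
    have "perm_act \<pi> (block_sums l ?P j) = block_sums l (\<lambda>j. \<pi> ` ?P j) j" for j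
    proof -
      have "perm_act \<pi> (mvar a) = mvar (\<pi> a)" for a by (simp add: perm_act_def)
      then show ?thesis
        by (simp add: block_sums_def \<pi>.map_sum sum.reindex[OF inj_on_subset[OF inj subset_UNIV]])
    qed
    then have "perm_act \<pi> (?S Q) = mp_subst (block_sums l (\<lambda>j. \<pi> ` ?P j)) (Phi l)"
      by (simp add: perm_act_def mp_subst_subst)
    also have "\<dots> = ?S (image \<pi> ` Q)"
    proof (rule Phi_block_sums_cong)
      have "inj_on (image \<pi>) Q" using inj by (auto simp: inj_on_def inj_image_eq_iff)
      then have "bij_betw (image \<pi>) Q (image \<pi> ` Q)" by (simp add: bij_betw_def)
      then show "bij_betw (\<lambda>j. \<pi> ` ?P j) {..<l} (image \<pi> ` Q)"
        using bij_betw_trans[OF part_enum_bij[OF Q]] by (simp add: comp_def)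
      show "bij_betw (part_enum l (image \<pi> ` Q)) {..<l} (image \<pi> ` Q)"
        by (rule part_enum_bij[OF part_set_permutes[OF \<pi> Q]])
    qed
    finally show ?thesis .
  qed
  have "perm_act \<pi> (Theta n l) = (\<Prod>Q\<in>part_set n l. ?S (image \<pi> ` Q))"
    by (simp add: Theta_block_sums \<pi>.map_prod step)
  also have "\<dots> = (\<Prod>Q\<in>part_set n l. ?S Q)"
    using part_set_permutes[OF \<pi>, of _ l] part_set_permutes[OF permutes_inv[OF \<pi>], of _ l]
    by (intro prod.reindex_bij_witness[where i = "image (image (inv_into UNIV \<pi>))" and j = "image (image \<pi>)"])
      (auto simp: image_image permutes_inverses[OF \<pi>])
  finally show ?thesis by (simp add: Theta_block_sums)
qed

text \<open>The first conjunct confines f to integral polynomials in n variables, as the fundamental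
  theorem requires; the second records the value of a lift without reducing complex
  coefficients.\<close>

definition int_value :: "nat \<Rightarrow> (nat \<Rightarrow> 'b::comm_ring_1) \<Rightarrow> complex mpoly \<Rightarrow> 'b \<Rightarrow> bool" where
  "int_value n w f b \<longleftrightarrow> f \<in> ring_gen (mvar ` {..<n}) \<and>
    (\<exists>P. mp_eval (\<lambda>c. mconst (of_int c)) mvar P = f \<and> mp_eval of_int w P = b)"

lemma subring_rel_int_value: "subring_rel (int_value n w)"
proof -
  interpret C: ring_morphism "mp_eval (\<lambda>c. mconst (of_int c :: complex)) mvar :: int mpoly \<Rightarrow> _"
    by (rule ring_morphism.ring_morphism_mp_eval[OF ring_morphism_mconst_of_int])
  interpret W: ring_morphism "mp_eval of_int w :: int mpoly \<Rightarrow> _"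
    by (rule ring_morphism.ring_morphism_mp_eval[OF ring_morphism_of_int])
  show ?thesis
  proof
    show "int_value n w 1 1"
      unfolding int_value_def using gen_1 C.map_1 W.map_1 by blast
    fix a a' b b' assume *: "int_value n w a a'" "int_value n w b b'"
    show "int_value n w (a - b) (a' - b')"
      using * unfolding int_value_def by (metis C.map_diff W.map_diff gen_diff)
    show "int_value n w (a * b) (a' * b')"
      using * unfolding int_value_def by (metis C.map_mult W.map_mult gen_mult)
  qed
qed

lemma int_value_mvar: "a < n \<Longrightarrow> int_value n w (mvar a) (w a)"
  unfolding int_value_def
  by (auto intro!: gen_base exI[of _ "mvar a"] simp: ring_morphism.mp_eval_mvar[OF ring_morphism_of_int]
      ring_morphism.mp_eval_mvar[OF ring_morphism_mconst_of_int])

text \<open>Here \<open>eps l\<close> is exchanged for \<omega>, a primitive root of the same order: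
  \<open>rel_norm_form\<close> is applied with \<open>mconst\<close> on one side and the identity on
  the other.\<close>

lemma int_value_norm_form:
  fixes w :: "nat \<Rightarrow> 'b::field"
  assumes "primitive_root l \<omega>" "\<And>j. j < l \<Longrightarrow> int_value n w (v j) (y j)"
  shows "int_value n w (norm_form l v) (\<Prod>i\<in>unit_residues l. \<Sum>j<l. \<omega> ^ (i * j) * y j)"
proof -
  interpret subring_rel "int_value n w" by (rule subring_rel_int_value)
  have "l > 0" using assms(1) by (simp add: primitive_root_def)
  then show ?thesis
    unfolding norm_form_def
    by (intro rel_norm_form[where \<kappa>' = "\<lambda>x. x"] primitive_root_eps assms ring_morphism_mconst ring_morphism_id)
qed

definition residue_block :: "nat \<Rightarrow> nat \<Rightarrow> nat \<Rightarrow> nat set" where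
  "residue_block n l j = {i. i \<in> {..<n} \<and> i mod l = j}"

lemma residue_blocks:
  assumes "l dvd n" "n > 0"
  shows "bij_betw (residue_block n l) {..<l} (residue_block n l ` {..<l})"
    and "residue_block n l ` {..<l} \<in> part_set n l"
proof -
  from assms obtain c where c: "n = l * c" by blast
  then have pos: "l > 0" "c > 0" using assms by auto
  have mem: "j \<in> residue_block n l j" if "j < l" for j
    using that c pos by (cases c) (auto simp: residue_block_def)
  have inj: "inj_on (residue_block n l) {..<l}"
  proof (rule inj_onI)
    fix x y assume "x \<in> {..<l}" "y \<in> {..<l}" "residue_block n l x = residue_block n l y"
    then have "x \<in> residue_block n l y" "x < l" using mem[of x] by auto
    then show "x = y" by (simp add: residue_block_def)
  qed
  then show "bij_betw (residue_block n l) {..<l} (residue_block n l ` {..<l})"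
    by (simp add: bij_betw_def)
  \<comment> \<open>Parametrizing a block by the quotients t < c yields its size c = n/l.\<close>
  have "residue_block n l j = (\<lambda>t. t * l + j) ` {..<c}" if j: "j < l" for j
  proof (intro equalityI subsetI)
    fix i assume "i \<in> residue_block n l j"
    then have i: "i < n" "i mod l = j" by (auto simp: residue_block_def)
    then have "i div l < c" by (simp add: c less_mult_imp_div_less mult.commute)
    moreover have "i = i div l * l + j" using i by (metis div_mult_mod_eq)
    ultimately show "i \<in> (\<lambda>t. t * l + j) ` {..<c}" by blast
  next
    fix i assume "i \<in> (\<lambda>t. t * l + j) ` {..<c}"
    then obtain t where t: "t < c" "i = t * l + j" by auto
    then have "i < Suc t * l" using j by simp
    also have "\<dots> \<le> c * l" using t by (intro mult_right_mono) auto
    finally show "i \<in> residue_block n l j" using t j by (auto simp: residue_block_def c mult.commute)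
  qed
  then have "card (residue_block n l j) = n div l" if "j < l" for j
    using that pos by (simp add: card_image inj_on_def c)
  moreover have "partition_on {..<n} (residue_block n l ` {..<l})"
  proof (rule partition_onI)
    show "\<Union>(residue_block n l ` {..<l}) = {..<n}" using pos by (auto simp: residue_block_def)
    show "{} \<notin> residue_block n l ` {..<l}" using mem by force
  qed (auto simp: residue_block_def disjnt_def)
  moreover have "card (residue_block n l ` {..<l}) = l" using inj by (simp add: card_image)
  ultimately show "residue_block n l ` {..<l} \<in> part_set n l"
    by (auto simp: part_set_def)
qed

text \<open>The linear factor belonging to the unit 1, written \<open>1 mod l\<close> because for l
  = 1 the only element of \<open>unit_residues l\<close> is 0.\<close>

lemma sum_residue_blocks:
  fixes \<omega> :: "'b::field"
  assumes "primitive_root l \<omega>"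
  shows "(\<Sum>j<l. \<omega> ^ ((1 mod l) * j) * (\<Sum>a\<in>residue_block n l j. w a)) = (\<Sum>a<n. \<omega> ^ a * w a)"
proof -
  have l: "l > 0" and \<omega>: "\<omega> ^ l = 1" using assms by (auto simp: primitive_root_def)
  have "\<omega> ^ ((1 mod l) * j) = \<omega> ^ a" if "a \<in> residue_block n l j" for j a
  proof -
    have "\<omega> ^ a = \<omega> ^ (l * (a div l) + a mod l)" by simp
    also have "\<dots> = \<omega> ^ (a mod l)" using \<omega> by (simp only: power_add power_mult) simp
    also have "a mod l = (1 mod l) * j"
      using that l by (cases "l = 1") (auto simp: residue_block_def)
    finally show ?thesis by simp
  qed
  then have "(\<Sum>j<l. \<omega> ^ ((1 mod l) * j) * (\<Sum>a\<in>residue_block n l j. w a)) =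
      (\<Sum>j<l. \<Sum>a\<in>residue_block n l j. \<omega> ^ a * w a)"
    by (simp add: sum_distrib_left)
  also have "\<dots> = (\<Sum>a<n. \<omega> ^ a * w a)"
    unfolding residue_block_def using l by (intro sum.group) auto
  finally show ?thesis .
qed

text \<open>The zero sits at the partition into residue classes modulo l, the identity member of the
  orbit and the unit 1; every other factor only needs some value.\<close>

lemma Theta_int_value_0:
  fixes w :: "nat \<Rightarrow> 'b::field"
  assumes l: "l dvd n" "n > 0" and \<omega>: "primitive_root l \<omega>" and zero: "(\<Sum>a<n. \<omega> ^ a * w a) = 0"
  shows "int_value n w (Theta n l) 0"
proof -
  interpret subring_rel "int_value n w" by (rule subring_rel_int_value)
  \<comment> \<open>The numbering P is kept free, to cover both the residue numbering and the one
    chosen by \<open>part_enum\<close>.\<close>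
  have factor: "int_value n w (mp_subst (block_sums l P) (perm_act \<sigma> (Psi l)))
      (\<Prod>i\<in>unit_residues l. \<Sum>j<l. \<omega> ^ (i * j) * (\<Sum>a\<in>P (\<sigma> j). w a))"
    if Q: "Q \<in> part_set n l" "bij_betw P {..<l} Q" and \<sigma>: "\<sigma> permutes {..<l}" for P Q \<sigma>
    unfolding mp_subst_perm_act mp_subst_Psi
  proof (rule int_value_norm_form[OF \<omega>])
    fix j assume "j < l"
    then have "\<sigma> j < l" using permutes_in_image[OF \<sigma>, of j] by simp
    moreover then have "P (\<sigma> j) \<in> Q" using Q(2) by (auto simp: bij_betw_def)
    then have "P (\<sigma> j) \<subseteq> {..<n}" using Q(1) by (auto simp: part_set_def dest!: partition_onD1)
    ultimately show "int_value n w (block_sums l P (\<sigma> j)) (\<Sum>a\<in>P (\<sigma> j). w a)"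
      by (auto simp: block_sums_def intro!: rel_sum int_value_mvar)
  qed
  have all: "\<exists>b. int_value n w (mp_subst (block_sums l P) F) b"
    if "Q \<in> part_set n l" "bij_betw P {..<l} Q" "F \<in> Psi_orbit l" for P Q F
    using factor that by (auto simp: Psi_orbit_def)
  let ?B = "residue_block n l" and ?Q = "residue_block n l ` {..<l}"
  note B = residue_blocks[OF l]
  show ?thesis
    unfolding Theta_block_sums
  proof (rule rel_prod_0[OF finite_part_set B(2)])
    have id: "id permutes {..<l}" by (rule permutes_id)
    have u: "1 mod l \<in> unit_residues l"
      using \<omega> by (cases "l = 1") (auto simp: unit_residues_def primitive_root_def)
    have "(\<Prod>i\<in>unit_residues l. \<Sum>j<l. \<omega> ^ (i * j) * (\<Sum>a\<in>?B (id j). w a)) = 0"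
    proof (rule prod_zero[OF finite_unit_residues bexI[OF _ u]])
      show "(\<Sum>j<l. \<omega> ^ (1 mod l * j) * (\<Sum>a\<in>?B (id j). w a)) = 0"
        unfolding id_apply using sum_residue_blocks[OF \<omega>, where n = n and w = w] zero by (rule trans)
    qed
    then have "int_value n w (mp_subst (block_sums l ?B) (perm_act id (Psi l))) 0"
      using factor[OF B(2) B(1) id] by (simp only:)
    then have "int_value n w (mp_subst (block_sums l ?B) (Phi l)) 0"
      unfolding mp_subst_Phi using id all[OF B(2) B(1)]
      by (intro rel_prod_0[OF finite_Psi_orbit, of "perm_act id (Psi l)"]) (auto simp: Psi_orbit_def)
    then show "int_value n w (mp_subst (block_sums l (part_enum l ?Q)) (Phi l)) 0"
      using Phi_block_sums_cong[OF B(1) part_enum_bij[OF B(2)]] by simp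
  next
    fix Q assume Q: "Q \<in> part_set n l"
    from all[OF Q part_enum_bij[OF Q]] obtain b where
      "\<And>F. F \<in> Psi_orbit l \<Longrightarrow> int_value n w (mp_subst (block_sums l (part_enum l Q)) F) (b F)" by metis
    then show "\<exists>b. int_value n w (mp_subst (block_sums l (part_enum l Q)) (Phi l)) b"
      unfolding mp_subst_Phi by (blast intro: rel_prod)
  qed
qed

section \<open>The polynomial theta and its values\<close>

lemma ring_gen_esym_int_mpoly:
  assumes "f \<in> ring_gen (esym n ` {1..n})"
  shows "\<exists>P. (\<forall>m\<in>Poly_Mapping.keys P. Poly_Mapping.keys m \<subseteq> {1..n}) \<and>
    mp_eval (\<lambda>c. mconst (of_int c)) (esym n) P = f"
proof -
  interpret E: ring_morphism "mp_eval (\<lambda>c. mconst (of_int c :: complex)) (esym n) :: int mpoly \<Rightarrow> _"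
    by (rule ring_morphism.ring_morphism_mp_eval[OF ring_morphism_mconst_of_int])
  show ?thesis using assms
  proof induction
    case (gen_base a)
    then obtain i where "i \<in> {1..n}" "a = esym n i" by blast
    moreover have "mp_eval (\<lambda>c. mconst (of_int c)) (esym n) (mvar i :: int mpoly) = esym n i"
      by (rule ring_morphism.mp_eval_mvar[OF ring_morphism_mconst_of_int])
    moreover have "\<forall>m\<in>Poly_Mapping.keys (mvar i :: int mpoly). Poly_Mapping.keys m = {i}"
      by (simp add: mvar_def)
    ultimately show ?case by (intro exI[of _ "mvar i"]) auto
  next
    case gen_1
    show ?case by (intro exI[of _ 1]) auto
  next
    case (gen_diff a b)
    then obtain P Q where "\<forall>m\<in>Poly_Mapping.keys P. Poly_Mapping.keys m \<subseteq> {1..n}"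
      "\<forall>m\<in>Poly_Mapping.keys Q. Poly_Mapping.keys m \<subseteq> {1..n}"
      "mp_eval (\<lambda>c. mconst (of_int c)) (esym n) P = a" "mp_eval (\<lambda>c. mconst (of_int c)) (esym n) Q = b" by blast
    then show ?case
      using keys_diff[of P Q] by (intro exI[of _ "P - Q"]) (auto simp: E.map_diff)
  next
    case (gen_mult a b)
    then obtain P Q where *: "\<forall>m\<in>Poly_Mapping.keys P. Poly_Mapping.keys m \<subseteq> {1..n}"
      "\<forall>m\<in>Poly_Mapping.keys Q. Poly_Mapping.keys m \<subseteq> {1..n}"
      "mp_eval (\<lambda>c. mconst (of_int c)) (esym n) P = a" "mp_eval (\<lambda>c. mconst (of_int c)) (esym n) Q = b" by blast
    have "Poly_Mapping.keys m \<subseteq> {1..n}" if m: "m \<in> Poly_Mapping.keys (P * Q)" for m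
    proof -
      obtain m1 m2 where "m = m1 + m2" "m1 \<in> Poly_Mapping.keys P" "m2 \<in> Poly_Mapping.keys Q"
        using keys_mult[of P Q] m by blast
      then show ?thesis using keys_add[of m1 m2] *(1,2) by blast
    qed
    then show ?case
      using * by (intro exI[of _ "P * Q"]) (auto simp: E.map_mult)
  qed
qed

text \<open>Makes the definite description meaningful: existence by the fundamental theorem, applied
  to the integral and symmetric \<open>Theta\<close>, uniqueness by
  \<open>esym_independent\<close>.\<close>

lemma theta_spec:
  assumes "Theta n l \<in> ring_gen (mvar ` {..<n})"
  shows "mp_eval (\<lambda>c. mconst (of_int c)) (esym n) (theta n l) = Theta n l"
    and "\<forall>m\<in>Poly_Mapping.keys (theta n l). Poly_Mapping.keys m \<subseteq> {1..n}"
proof -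
  let ?S = "\<lambda>P :: int mpoly. (\<forall>m\<in>Poly_Mapping.keys P. Poly_Mapping.keys m \<subseteq> {1..n}) \<and>
      mp_eval (\<lambda>c. mconst (of_int c)) (esym n) P = Theta n l"
  interpret E: ring_morphism "mp_eval (\<lambda>c. mconst (of_int c :: complex)) (esym n) :: int mpoly \<Rightarrow> _"
    by (rule ring_morphism.ring_morphism_mp_eval[OF ring_morphism_mconst_of_int])
  have "Theta n l \<in> ring_gen ({} \<union> elem_sym n mvar ` {1..n})"
  proof (rule symmetric_in_ring_gen_elem_sym)
    show "inj_on (mvar :: nat \<Rightarrow> complex mpoly) {..<n}" by (auto simp: inj_on_def)
    show "Theta n l \<in> ring_gen ({} \<union> mvar ` {..<n})" using assms by simp
    fix \<pi> assume "\<pi> permutes {..<n}"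
    then show "\<exists>h. ring_morphism h \<and> (\<forall>a\<in>{}. h a = a) \<and> (\<forall>i<n. h (mvar i) = mvar (\<pi> i)) \<and> h (Theta n l) = Theta n l"
      using perm_act_Theta[of \<pi> n l] ring_morphism_mp_subst
      by (intro exI[of _ "mp_subst (\<lambda>j. mvar (\<pi> j))"]) (auto simp: perm_act_def)
  qed
  moreover have "esym n = elem_sym n mvar" by (rule ext) (rule esym_eq_elem_sym)
  ultimately obtain P where P: "?S P" using ring_gen_esym_int_mpoly[of "Theta n l" n] by auto
  have unique: "Q = P" if Q: "?S Q" for Q
  proof -
    have "Q - P = 0"
    proof (rule esym_independent)
      show "Poly_Mapping.keys m \<subseteq> {1..n}" if "m \<in> Poly_Mapping.keys (Q - P)" for m
        using keys_diff[of Q P] that P Q by blast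
      show "mp_eval (\<lambda>c. mconst (of_int c)) (esym n) (Q - P) = 0" using P Q by (simp add: E.map_diff)
    qed
    then show ?thesis by simp
  qed
  have "?S (theta n l)" unfolding theta_def by (rule theI[of ?S, OF P unique])
  then show "mp_eval (\<lambda>c. mconst (of_int c)) (esym n) (theta n l) = Theta n l"
    "\<forall>m\<in>Poly_Mapping.keys (theta n l). Poly_Mapping.keys m \<subseteq> {1..n}" by auto
qed

text \<open>The bound on the variables is carried along because the coefficients of f will be
  compared with \<open>elem_sym\<close> only at the indices 1 to n.\<close>

theorem theta_eval_eq_0:
  fixes w :: "nat \<Rightarrow> 'b::field"
  assumes "l dvd n" "n > 0" "primitive_root l \<omega>" "(\<Sum>a<n. \<omega> ^ a * w a) = 0"
  shows "mp_eval of_int (elem_sym n w) (theta n l) = 0"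
    and "\<forall>m\<in>Poly_Mapping.keys (theta n l). Poly_Mapping.keys m \<subseteq> {1..n}"
proof -
  from Theta_int_value_0[OF assms] obtain P where gen: "Theta n l \<in> ring_gen (mvar ` {..<n})"
    and P: "mp_eval (\<lambda>c. mconst (of_int c)) mvar P = Theta n l" "mp_eval of_int w P = 0"
    by (auto simp: int_value_def)
  show "\<forall>m\<in>Poly_Mapping.keys (theta n l). Poly_Mapping.keys m \<subseteq> {1..n}"
    by (rule theta_spec(2)[OF gen])
  \<comment> \<open>T is theta rewritten in X_0, ..., X_(n-1). It has the same complex image as the
    lift P, hence equals it, and P vanishes at w.\<close>
  define T where "T = mp_subst (elem_sym n mvar) (theta n l)"
  interpret C: ring_morphism "mp_eval (\<lambda>c. mconst (of_int c :: complex)) mvar :: int mpoly \<Rightarrow> _"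
    by (rule ring_morphism.ring_morphism_mp_eval[OF ring_morphism_mconst_of_int])
  interpret W: ring_morphism "mp_eval of_int w :: int mpoly \<Rightarrow> _"
    by (rule ring_morphism.ring_morphism_mp_eval[OF ring_morphism_of_int])
  have "mp_eval (\<lambda>c. mconst (of_int c)) mvar T = mp_eval (\<lambda>c. mconst (of_int c)) (esym n) (theta n l)"
    by (simp add: T_def ring_morphism.mp_eval_subst[OF ring_morphism_mconst_of_int] C.map_elem_sym
        ring_morphism.mp_eval_mvar[OF ring_morphism_mconst_of_int] esym_eq_elem_sym [abs_def])
  then have "T = P"
    using theta_spec(1)[OF gen] P(1) by (intro int_mpoly_embed_inj) simp
  moreover have "mp_eval of_int w T = mp_eval of_int (elem_sym n w) (theta n l)"
    by (simp add: T_def ring_morphism.mp_eval_subst[OF ring_morphism_of_int] W.map_elem_sym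
        ring_morphism.mp_eval_mvar[OF ring_morphism_of_int])
  ultimately show "mp_eval of_int (elem_sym n w) (theta n l) = 0" using P(2) by simp
qed

section \<open>Cyclic linear dependence\<close>

text \<open>Serves two ideals: the relations among the shifts of a sequence, and the polynomials
  over F_q vanishing at a given root. An element of least degree generates.\<close>

lemma poly_ideal_generator:
  fixes I :: "'a::field poly set"
  assumes "a0 \<in> I" "a0 \<noteq> 0"
    and diff: "\<And>a b. a \<in> I \<Longrightarrow> b \<in> I \<Longrightarrow> a - b \<in> I"
    and mult: "\<And>a c. a \<in> I \<Longrightarrow> c * a \<in> I"
  shows "\<exists>g\<in>I. g \<noteq> 0 \<and> (\<forall>a\<in>I. g dvd a)"
proof -
  obtain g where g: "g \<in> I" "g \<noteq> 0" and min: "\<And>a. a \<in> I \<Longrightarrow> a \<noteq> 0 \<Longrightarrow> degree g \<le> degree a"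
    using ex_has_least_nat[of "\<lambda>a. a \<in> I \<and> a \<noteq> 0" a0 degree] assms(1,2) by blast
  have "g dvd a" if "a \<in> I" for a
  proof -
    have "a mod g = a - a div g * g" by (simp add: minus_div_mult_eq_mod)
    then have "a mod g \<in> I" using diff mult that g(1) by simp
    then have "a mod g = 0"
      using min[of "a mod g"] degree_mod_less[OF g(2), of a] by fastforce
    then show ?thesis by blast
  qed
  then show ?thesis using g by blast
qed

text \<open>The value at k of g(E) s, where E shifts sequences by one: polynomials act on sequences,
  and the annihilator of s is an ideal.\<close>

definition shift_apply :: "(nat \<Rightarrow> 'a::comm_ring_1) \<Rightarrow> 'a poly \<Rightarrow> nat \<Rightarrow> 'a" where
  "shift_apply s g k = (\<Sum>i\<le>degree g. coeff g i * s (i + k))"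

lemma shift_apply_bound:
  assumes "degree g \<le> N"
  shows "shift_apply s g k = (\<Sum>i\<le>N. coeff g i * s (i + k))"
  unfolding shift_apply_def
  by (rule sum.mono_neutral_left) (use assms in \<open>auto simp: coeff_eq_0\<close>)

lemma shift_apply_diff: "shift_apply s (g - h) k = shift_apply s g k - shift_apply s h k"
proof -
  let ?N = "max (degree g) (degree h)"
  have "degree (g - h) \<le> ?N" by (rule degree_diff_le_max)
  then show ?thesis
    by (simp add: shift_apply_bound[of _ ?N] sum_subtractf left_diff_distrib)
qed

lemma shift_apply_add: "shift_apply s (g + h) k = shift_apply s g k + shift_apply s h k"
proof -
  let ?N = "max (degree g) (degree h)"
  have "degree (g + h) \<le> ?N" by (rule degree_add_le_max)
  then show ?thesis
    by (simp add: shift_apply_bound[of _ ?N] sum.distrib distrib_right)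
qed

lemma shift_apply_0 [simp]: "shift_apply s 0 k = 0"
  by (simp add: shift_apply_def)

lemma shift_apply_sum: "shift_apply s (\<Sum>i\<in>A. g i) k = (\<Sum>i\<in>A. shift_apply s (g i) k)"
  by (induction A rule: infinite_finite_induct) (auto simp: shift_apply_add)

lemma shift_apply_smult: "shift_apply s (smult c g) k = c * shift_apply s g k"
  by (subst shift_apply_bound[OF degree_smult_le]) (simp add: shift_apply_def sum_distrib_left mult.assoc)

lemma shift_apply_pCons_0: "shift_apply s (pCons 0 g) k = shift_apply s g (Suc k)"
proof -
  have "degree (pCons 0 g) \<le> Suc (degree g)" by (rule degree_pCons_le)
  then have "shift_apply s (pCons 0 g) k = (\<Sum>i\<le>Suc (degree g). coeff (pCons 0 g) i * s (i + k))"
    by (rule shift_apply_bound)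
  then show ?thesis by (simp add: sum.atMost_Suc_shift shift_apply_def del: sum.atMost_Suc)
qed

lemma shift_apply_monom: "shift_apply s (monom c i) k = c * s (i + k)"
proof (induction i arbitrary: k)
  case 0
  then show ?case by (simp add: shift_apply_def monom_0)
next
  case (Suc i)
  then show ?case by (simp add: monom_Suc shift_apply_pCons_0)
qed

text \<open>X acts as the shift, so the induction on c passes from k to k + 1 and needs the
  vanishing at all k.\<close>

lemma shift_apply_mult_eq_0:
  assumes "\<And>k. shift_apply s g k = 0"
  shows "shift_apply s (c * g) k = 0"
  by (induction c arbitrary: k) (auto simp: shift_apply_add shift_apply_smult shift_apply_pCons_0 assms)

text \<open>The relations among the cyclic shifts of \<open>s\<close> form an ideal of the polynomial ring
  containing \<open>X^n - 1\<close>. If it is larger, then it contains \<open>(X^n - 1) / (X - \<zeta>)\<close> for some root \<open>\<zeta>\<close>.\<close>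

theorem periodic_dependent_imp_character_sum_0:
  fixes s c :: "nat \<Rightarrow> 'a::alg_closed_field"
  assumes n: "n > 0" and periodic: "\<And>i. s (i + n) = s i"
    and dep: "\<And>k. (\<Sum>i<n. c i * s (i + k)) = 0" and nz: "i0 < n" "c i0 \<noteq> 0"
  shows "\<exists>\<omega>. \<omega> ^ n = 1 \<and> (\<Sum>i<n. \<omega> ^ i * s i) = 0"
proof -
  define I where "I = {g. \<forall>k. shift_apply s g k = 0}"
  have diff: "a - b \<in> I" if "a \<in> I" "b \<in> I" for a b using that by (simp add: I_def shift_apply_diff)
  have mult: "d * a \<in> I" if "a \<in> I" for a d using that by (simp add: I_def shift_apply_mult_eq_0)
  define c' where "c' = (\<Sum>i<n. monom (c i) i)"
  have c': "c' \<in> I" using dep by (simp add: I_def c'_def shift_apply_sum shift_apply_monom)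
  have coeff_c': "coeff c' j = (if j < n then c j else 0)" for j
    by (simp add: c'_def coeff_sum coeff_monom sum.delta)
  then have "c' \<noteq> 0" using nz by (metis coeff_0)
  have "degree c' \<le> n - 1" using coeff_c' by (intro degree_le) auto
  then have deg_c': "degree c' < n" using n by simp
  obtain g where g: "g \<in> I" "g \<noteq> 0" and dvd: "\<And>a. a \<in> I \<Longrightarrow> g dvd a"
    using poly_ideal_generator[OF c' \<open>c' \<noteq> 0\<close> diff mult] by blast
  \<comment> \<open>The nontrivial relation of degree below n makes g a proper divisor of X^n - 1; a
    root of the cofactor u will be \<zeta>.\<close>
  have deg_g: "degree g < n" using dvd_imp_degree_le[OF dvd[OF c'] \<open>c' \<noteq> 0\<close>] deg_c' by simp
  have deg_X: "degree (monom 1 n - 1 :: 'a poly) = n"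
    using n by (intro antisym degree_le le_degree) (auto simp: coeff_1)
  have "monom 1 n - monom 1 0 \<in> I"
    unfolding I_def mem_Collect_eq shift_apply_diff shift_apply_monom
    using periodic by (simp add: add.commute)
  then obtain u where u: "monom 1 n - 1 = g * u" using dvd by (auto simp: dvd_def)
  then have "u \<noteq> 0" using deg_X n by force
  then have "degree u > 0" using u deg_X deg_g g(2) by (metis add.right_neutral degree_mult_eq gr0I nat_neq_iff)
  then obtain \<zeta> where "poly u \<zeta> = 0" using alg_closed_imp_poly_has_root by blast
  then obtain u' where u': "u = [:- \<zeta>, 1:] * u'" by (auto simp: poly_eq_0_iff_dvd)
  have "poly (monom 1 n - 1) \<zeta> = 0" unfolding u u' by simp
  then have \<zeta>: "\<zeta> ^ n = 1" by (simp add: poly_monom)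
  define y :: "'a poly" where "y = [:0, 1:]"
  have ypow: "y ^ i = monom 1 i" for i by (simp add: y_def monom_altdef)
  \<comment> \<open>The quotient (X^n - 1)/(X - \<zeta>) as a geometric sum in y = X, which displays
    its coefficients as powers of \<zeta>.\<close>
  define h where "h = (\<Sum>i<n. [:\<zeta>:] ^ (n - Suc i) * y ^ i)"
  have "[:\<zeta>:] ^ n = 1" using \<zeta> by (simp add: poly_const_pow)
  then have "[:- \<zeta>, 1:] * (g * u') = y ^ n - [:\<zeta>:] ^ n"
    using u u' by (simp add: ypow mult_ac del: mult_pCons_left mult_pCons_right)
  also have "\<dots> = [:- \<zeta>, 1:] * h"
    unfolding power_diff_sumr2 h_def by (simp add: y_def)
  finally have "g * u' = h" by (subst (asm) mult_cancel_left) auto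
  then have "h = u' * g" by (simp add: mult.commute)
  then have "h \<in> I" using mult[OF g(1)] by simp
  then have "0 = shift_apply s h 0" by (simp add: I_def)
  also have "\<dots> = (\<Sum>i<n. \<zeta> ^ (n - Suc i) * s i)"
    by (simp add: h_def shift_apply_sum ypow poly_const_pow smult_monom shift_apply_monom)
  finally have sum0: "(\<Sum>i<n. \<zeta> ^ (n - Suc i) * s i) = 0" by simp
  have "\<zeta> \<noteq> 0" using \<zeta> n by (auto simp: power_0_left)
  \<comment> \<open>The powers \<zeta>^(n-1-i) run in reverse; dividing by \<zeta>^(n-1) turns them
    into powers of \<omega> = 1/\<zeta>.\<close>
  have scale: "inverse \<zeta> ^ (n - 1) * (\<zeta> ^ (n - Suc i) * s i) = inverse \<zeta> ^ i * s i" if "i < n" for i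
  proof -
    have "n - 1 = i + (n - Suc i)" using that by simp
    then have "inverse \<zeta> ^ (n - 1) * \<zeta> ^ (n - Suc i) = inverse \<zeta> ^ i * (inverse \<zeta> * \<zeta>) ^ (n - Suc i)"
      by (simp only: power_add power_mult_distrib mult.assoc)
    moreover have "inverse \<zeta> * \<zeta> = 1" using \<open>\<zeta> \<noteq> 0\<close> by simp
    ultimately have "inverse \<zeta> ^ (n - 1) * \<zeta> ^ (n - Suc i) = inverse \<zeta> ^ i"
      by (simp only: power_one mult_1_right)
    then show ?thesis by (simp only: mult.assoc[symmetric])
  qed
  have "inverse \<zeta> ^ (n - 1) * (\<Sum>i<n. \<zeta> ^ (n - Suc i) * s i) = (\<Sum>i<n. inverse \<zeta> ^ i * s i)"
    unfolding sum_distrib_left by (intro sum.cong refl) (simp only: lessThan_iff scale)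
  then have "(\<Sum>i<n. inverse \<zeta> ^ i * s i) = 0" using sum0 by simp
  moreover have "inverse \<zeta> ^ n = 1" using \<zeta> by (simp add: power_inverse)
  ultimately show ?thesis by blast
qed

section \<open>Conjugate roots over a finite field\<close>

text \<open>Multiplication by a nonzero x permutes the nonzero elements, so their product absorbs a
  power of x.\<close>

lemma power_card_finite_field:
  fixes x :: "'a::{field,finite}"
  shows "x ^ card (UNIV :: 'a set) = x"
proof (cases "x = 0")
  case False
  have "(\<Prod>y\<in>UNIV - {0}. x * y) = (\<Prod>y\<in>UNIV - {0}. y)"
    by (rule prod.reindex_bij_witness[of _ "\<lambda>y. y / x" "\<lambda>y. x * y"]) (use False in auto)
  then have "x ^ card (UNIV - {0 :: 'a}) = 1"
    by (simp add: prod.distrib)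
  moreover have "card (UNIV :: 'a set) = Suc (card (UNIV - {0 :: 'a}))"
    by (simp add: card_Diff_singleton card_gt_0_iff)
  ultimately show ?thesis by (simp del: card_Diff_insert)
qed (simp add: card_gt_0_iff)

text \<open>Translation by 1 permutes the ring, so the sum of all elements does not change when the
  cardinality is added.\<close>

lemma of_nat_card_finite_ring: "of_nat (card (UNIV :: 'a set)) = (0 :: 'a::{ring_1,finite})"
proof -
  have "(\<Sum>x\<in>UNIV. x + 1) = (\<Sum>x\<in>UNIV. x :: 'a)"
    by (rule sum.reindex_bij_witness[of _ "\<lambda>x. x - 1" "\<lambda>x. x + 1"]) auto
  then show ?thesis by (simp add: sum.distrib)
qed

lemma CHAR_eq_prime:
  assumes "prime p" "of_nat p = (0 :: 'a::field)"
  shows "CHAR('a) = p"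
  using assms by (metis CHAR_not_1' One_nat_def of_nat_eq_0_iff_char_dvd prime_nat_iff)

text \<open>The p-th power map is additive, so (x - 1)^p = x^p - 1 = 0.\<close>

lemma power_prime_char_eq_1:
  fixes x :: "'a::field"
  assumes "prime p" "CHAR('a) = p" "x ^ p = 1"
  shows "x = 1"
proof -
  have "((x - 1) + 1) ^ p = (x - 1) ^ p + 1 ^ p"
    using assms by (intro freshmans_dream) auto
  then have "(x - 1) ^ p = 0" using assms(3) by simp
  then show ?thesis by simp
qed

lemma ring_morphism_field_eq_0_iff:
  fixes h :: "'a::field \<Rightarrow> 'b::field"
  assumes "ring_morphism h"
  shows "h x = 0 \<longleftrightarrow> x = 0"
proof -
  interpret ring_morphism h by fact
  show ?thesis using map_mult[of x "inverse x"] by (cases "x = 0") auto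
qed

text \<open>Here \<open>'a\<close> is F_q, and \<open>'b\<close> is an arbitrary field containing it
  by \<phi>, in which f may or may not have roots.\<close>

locale finite_field_embedding = ring_morphism \<phi> for \<phi> :: "'a::{field,finite} \<Rightarrow> 'b::field" +
  fixes p q e :: nat
  assumes p: "prime p" and q: "q = card (UNIV :: 'a set)" and q_power: "q = p ^ e"
begin

lemma CHAR_base: "CHAR('a) = p"
proof (rule CHAR_eq_prime[OF p])
  have "(of_nat p :: 'a) ^ e = of_nat q" by (simp add: q_power)
  also have "\<dots> = 0" unfolding q by (rule of_nat_card_finite_ring)
  finally show "(of_nat p :: 'a) = 0" by simp
qed

lemma CHAR_ext: "CHAR('b) = p"
proof (rule CHAR_eq_prime[OF p])
  have "(of_nat p :: 'b) = \<phi> (of_nat p)" by simp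
  also have "of_nat p = (0 :: 'a)" using CHAR_base by (metis of_nat_CHAR)
  finally show "(of_nat p :: 'b) = 0" by simp
qed

lemma ring_morphism_frobenius: "ring_morphism (\<lambda>x :: 'b. x ^ q)"
proof
  show "(x + y) ^ q = x ^ q + y ^ q" for x y :: 'b
    using p CHAR_ext q_power by (intro freshmans_dream') auto
qed (simp_all add: power_mult_distrib)

lemma ring_morphism_frobenius_iter: "ring_morphism (\<lambda>x :: 'b. x ^ (q ^ k))"
proof
  show "(x + y) ^ (q ^ k) = x ^ (q ^ k) + y ^ (q ^ k)" for x y :: 'b
    using p CHAR_ext q_power by (intro freshmans_dream'[of _ "e * k"]) (auto simp: power_mult)
qed (simp_all add: power_mult_distrib)

lemma frobenius_fixes: "\<phi> x ^ q = \<phi> x"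
  using power_card_finite_field[of x] by (simp add: q flip: map_power)

lemma frobenius_iter_fixes: "\<phi> x ^ (q ^ k) = \<phi> x"
  by (induction k) (simp_all add: power_mult frobenius_fixes)

lemma q_gt_1: "q > 1"
  unfolding q using card_mono[of UNIV "{0, 1 :: 'a}"] by simp

lemma eq_0_iff [simp]: "\<phi> x = 0 \<longleftrightarrow> x = 0"
  by (rule ring_morphism_field_eq_0_iff) (rule ring_morphism_axioms)

lemma inj: "inj \<phi>"
  by (rule injI) (metis eq_0_iff map_diff right_minus_eq)

text \<open>The image of \<phi> already supplies q roots of X^q - X, which has at most q.\<close>

lemma fixed_in_range:
  assumes "y ^ q = y"
  shows "y \<in> range \<phi>"
proof -
  define P :: "'b poly" where "P = monom 1 q - [:0, 1:]"
  have "coeff P q = 1" using q_gt_1 by (auto simp: P_def coeff_pCons split: nat.splits)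
  then have "P \<noteq> 0" by auto
  have "degree P \<le> q"
    using q_gt_1 unfolding P_def by (intro degree_diff_le degree_monom_le) auto
  then have "card {y. poly P y = 0} \<le> card (range \<phi>)"
    using card_poly_roots_bound[OF \<open>P \<noteq> 0\<close>] card_image[OF inj] q by simp
  moreover have "range \<phi> \<subseteq> {y. poly P y = 0}"
    by (auto simp: P_def poly_monom frobenius_fixes)
  ultimately have "range \<phi> = {y. poly P y = 0}"
    by (intro card_seteq poly_roots_finite \<open>P \<noteq> 0\<close>) auto
  then show ?thesis using assms by (simp add: P_def poly_monom)
qed

section \<open>Minimal polynomials and Frobenius orbits\<close>

lemma degree_map: "degree (map_poly \<phi> g) = degree g"
  by (rule degree_map_poly) simp

lemma poly_map_frobenius: "poly (map_poly \<phi> g) (x ^ q) = poly (map_poly \<phi> g) x ^ q"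
proof -
  interpret F: ring_morphism "\<lambda>x :: 'b. x ^ q" by (rule ring_morphism_frobenius)
  show ?thesis
    by (simp add: poly_altdef degree_map coeff_map_poly F.map_sum power_mult_distrib frobenius_fixes
        flip: power_mult) (simp add: mult.commute)
qed

text \<open>The generator of the ideal of polynomials vanishing at r is a nonunit divisor of the
  irreducible f, hence associated to it.\<close>

lemma irreducible_dvd_of_common_root:
  assumes "irreducible f" "poly (map_poly \<phi> f) r = 0" "poly (map_poly \<phi> g) r = 0"
  shows "f dvd g"
proof -
  define I where "I = {a. poly (map_poly \<phi> a) r = 0}"
  have map_poly_diff: "map_poly \<phi> (a - b) = map_poly \<phi> a - map_poly \<phi> b" for a b
    by (rule poly_eqI) (simp add: coeff_map_poly map_diff)
  have "f \<noteq> 0" using assms(1) by auto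
  then obtain d where d: "d \<in> I" "d \<noteq> 0" "\<And>a. a \<in> I \<Longrightarrow> d dvd a"
    using poly_ideal_generator[of f I] assms by (auto simp: I_def map_poly_diff map_poly_mult)
  have "\<not> is_unit d"
  proof
    assume "is_unit d"
    then obtain c where "d = [:c:]" "c \<noteq> 0" by (auto simp: is_unit_poly_iff dvd_field_iff)
    then show False using d(1) by (simp add: I_def map_poly_pCons)
  qed
  moreover obtain k where k: "f = d * k" using d(3)[of f] assms(2) by (auto simp: I_def dvd_def)
  ultimately have "is_unit k" using assms(1) irreducibleD by blast
  then have "f dvd d" unfolding k by (simp add: mult_unit_dvd_iff)
  then show ?thesis using d(3)[of g] assms(3) dvd_trans by (auto simp: I_def)
qed

text \<open>Let d be the first return time of the Frobenius orbit of r. The product over the orbit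
  is fixed by Frobenius, so it comes from F_q and is divisible by f, whence n \<le> d; the d
  distinct roots of f give d \<le> n. In particular one root in \<open>'b\<close> brings all n of
  them.\<close>

theorem conjugate_roots:
  assumes f: "lead_coeff f = 1" "degree f = n" "irreducible f"
    and r: "poly (map_poly \<phi> f) r = 0"
  defines "s \<equiv> \<lambda>i. r ^ (q ^ i)"
  shows "inj_on s {..<n}" and "s (i + n) = s i"
    and "map_poly \<phi> f = (\<Prod>i<n. [:- s i, 1:])"
proof -
  interpret F: ring_morphism "\<lambda>x :: 'b. x ^ q" by (rule ring_morphism_frobenius)
  have s_add: "s (i + j) = s i ^ (q ^ j)" for i j
    by (simp add: s_def power_add power_mult)
  \<comment> \<open>Frobenius is injective, so coincidences can be shifted back: the orbit is purely
    periodic and returns to r itself.\<close>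
  have cancel: "s i = s 0" if "s (i + k) = s k" for i k
  proof -
    interpret Fk: ring_morphism "\<lambda>x :: 'b. x ^ (q ^ k)" by (rule ring_morphism_frobenius_iter)
    have "(s i - s 0) ^ (q ^ k) = 0"
      using that s_add[of i k] s_add[of 0 k] by (simp add: Fk.map_diff)
    then show ?thesis by simp
  qed
  have root: "poly (map_poly \<phi> f) (s i) = 0" for i
  proof (induction i)
    case (Suc i)
    have "s (Suc i) = s i ^ q" using s_add[of i 1] by simp
    then show ?case using Suc q_gt_1 by (simp add: poly_map_frobenius)
  qed (simp add: s_def r)
  have f0: "map_poly \<phi> f \<noteq> 0"
    using f(1) degree_map[of f] by (metis coeff_map_poly leading_coeff_0_iff map_0 map_1 zero_neq_one)
  have "finite (range s)"
    by (rule finite_subset[OF _ poly_roots_finite[OF f0]]) (auto simp: root)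
  then obtain j k where "j < k" "s j = s k"
    using infinite_UNIV_nat by (metis finite_imageD injI linorder_neqE_nat)
  then have "s (k - j) = s 0" "k - j > 0" using cancel[of "k - j" j] by auto
  then have ex: "\<exists>d. d > 0 \<and> s d = s 0" by blast
  define d where "d = (LEAST d. d > 0 \<and> s d = s 0)"
  have d: "d > 0" "s d = s 0" using LeastI_ex[OF ex] by (auto simp: d_def)
  have d_min: "d \<le> k" if "k > 0" "s k = s 0" for k using that by (auto simp: d_def intro: Least_le)
  have inj_d: "inj_on s {..<d}"
  proof (rule linorder_inj_onI)
    fix i j :: nat assume ij: "i < j" "i \<in> {..<d}" "j \<in> {..<d}"
    show "s i \<noteq> s j"
    proof
      assume "s i = s j"
      then have "s (j - i) = s 0" using cancel[of "j - i" i] ij by simp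
      then show False using d_min[of "j - i"] ij by auto
    qed
  qed auto
  define g where "g = (\<Prod>i<d. [:- s i, 1:])"
  have "map_poly (\<lambda>x. x ^ q) g = (\<Prod>i<d. [:- s (Suc i), 1:])"
  proof -
    have "map_poly (\<lambda>x. x ^ q) [:- s i, 1:] = [:- s (Suc i), 1:]" for i
      using s_add[of i 1] by (simp add: map_poly_pCons F.map_uminus)
    then show ?thesis unfolding g_def by (simp add: F.map_poly_prod)
  qed
  \<comment> \<open>Frobenius only rotates the factors, since s d = s 0.\<close>
  also have "\<dots> = g"
  proof -
    obtain d' where d': "d = Suc d'" using d(1) by (cases d) auto
    have "(\<Prod>i<Suc d'. [:- s (Suc i), 1:]) = (\<Prod>i<d'. [:- s (Suc i), 1:]) * [:- s 0, 1:]"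
      using d(2) unfolding prod.lessThan_Suc d' by simp
    also have "\<dots> = (\<Prod>i<Suc d'. [:- s i, 1:])"
      unfolding prod.lessThan_Suc_shift by (rule mult.commute)
    finally show ?thesis by (simp only: g_def d')
  qed
  finally have "coeff g i ^ q = coeff g i" for i
    using coeff_map_poly[of "\<lambda>x :: 'b. x ^ q" g i] q_gt_1 by simp
  then have in_range: "coeff g i \<in> range \<phi>" for i by (rule fixed_in_range)
  define g0 where "g0 = map_poly (inv_into UNIV \<phi>) g"
  have "inv_into UNIV \<phi> 0 = 0" using inv_f_f[OF inj, of 0] by simp
  then have g0: "map_poly \<phi> g0 = g"
    unfolding g0_def using in_range
    by (intro poly_eqI) (simp add: coeff_map_poly f_inv_into_f)
  have deg_g: "degree g = d" by (simp add: g_def degree_prod_linear)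
  have lead_g: "coeff g d = 1"
    using lead_coeff_prod_linear[of "\<lambda>i. - s i" "{..<d}"] deg_g by (simp add: g_def)
  have "poly g r = 0" using d(1) by (auto simp: g_def poly_prod s_def intro!: bexI[of _ 0])
  then have "f dvd g0" using irreducible_dvd_of_common_root[OF f(3) r] g0 by simp
  moreover have "g0 \<noteq> 0" using g0 deg_g d(1) by auto
  ultimately have "n \<le> d"
    using dvd_imp_degree_le[of f g0] degree_map[of g0] f(2) g0 deg_g by simp
  moreover have "d \<le> n"
  proof -
    have "d = card (s ` {..<d})" using card_image[OF inj_d] by simp
    also have "\<dots> \<le> card {x. poly (map_poly \<phi> f) x = 0}"
      by (rule card_mono[OF poly_roots_finite[OF f0]]) (auto simp: root)
    also have "\<dots> \<le> n" using card_poly_roots_bound[OF f0] f(2) degree_map[of f] by simp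
    finally show ?thesis .
  qed
  ultimately have dn: "d = n" by simp
  show "inj_on s {..<n}" using inj_d dn by simp
  show "s (i + n) = s i"
    using s_add[of n i] s_add[of 0 i] d(2) dn by (simp add: add.commute)
  show "map_poly \<phi> f = (\<Prod>i<n. [:- s i, 1:])"
  proof (rule poly_eqI_degree_lead_coeff[where n = n and A = "s ` {..<n}"])
    show "coeff (map_poly \<phi> f) n = coeff (\<Prod>i<n. [:- s i, 1:]) n"
      using lead_g f(1,2) by (simp add: coeff_map_poly g_def dn)
    show "n \<le> card (s ` {..<n})" using card_image[OF inj_d] dn by simp
    show "degree (map_poly \<phi> f) \<le> n" using degree_map[of f] f(2) by simp
    show "degree (\<Prod>i<n. [:- s i, 1:]) \<le> n" by (simp add: degree_prod_linear)
    fix z assume "z \<in> s ` {..<n}"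
    then show "poly (map_poly \<phi> f) z = poly (\<Prod>i<n. [:- s i, 1:]) z"
      by (auto simp: root poly_prod prod_zero_iff)
  qed
qed

end

section \<open>Normality\<close>

text \<open>If p divided the order l, then \<omega>^(l/p) would be a p-th root of unity other than
  1, which characteristic p excludes. So l is prime to the p-part of n and divides the
  cofactor.\<close>

lemma root_of_unity_order:
  fixes \<omega> :: "'a::field"
  assumes "prime p" "CHAR('a) = p" "n > 0" "\<omega> ^ n = 1"
  shows "\<exists>l. primitive_root l \<omega> \<and> l dvd n div p ^ multiplicity p n"
proof -
  define l where "l = (LEAST l. l > 0 \<and> \<omega> ^ l = 1)"
  have ex: "\<exists>l. l > 0 \<and> \<omega> ^ l = 1" using assms(3,4) by blast
  have l: "l > 0" "\<omega> ^ l = 1" using LeastI_ex[OF ex] by (auto simp: l_def)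
  have min: "l \<le> k" if "k > 0" "\<omega> ^ k = 1" for k using that by (auto simp: l_def intro: Least_le)
  have prim: "primitive_root l \<omega>"
    using l min by (auto simp: primitive_root_def dest: leD)
  have "\<omega> ^ n = \<omega> ^ (l * (n div l) + n mod l)" by simp
  also have "\<dots> = \<omega> ^ (n mod l)" using l(2) by (simp only: power_add power_mult) simp
  finally have "n mod l = 0" using assms(4) min[of "n mod l"] l(1) mod_less_divisor[of l n] by fastforce
  then have "l dvd n" by blast
  have "\<not> p dvd l"
  proof
    assume "p dvd l"
    then obtain k where k: "l = p * k" by blast
    then have "(\<omega> ^ k) ^ p = 1" using l(2) by (simp add: mult.commute flip: power_mult)
    then have "\<omega> ^ k = 1" by (rule power_prime_char_eq_1[OF assms(1,2)])
    moreover have "0 < k" "k < l" using k l(1) prime_gt_1_nat[OF assms(1)] by auto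
    ultimately show False using min[of k] by simp
  qed
  then have "coprime p l" by (rule prime_imp_coprime[OF assms(1)])
  then have cop: "coprime l (p ^ multiplicity p n)" by (simp add: coprime_commute)
  have "l dvd p ^ multiplicity p n * (n div p ^ multiplicity p n)"
    unfolding dvd_mult_div_cancel[OF multiplicity_dvd] by fact
  then have "l dvd n div p ^ multiplicity p n"
    by (simp only: coprime_dvd_mult_right_iff[OF cop])
  then show ?thesis using prim by blast
qed

theorem theorem4p1:
  fixes p n :: nat and f :: "'a::{field,finite} poly"
  assumes "prime p"
    and "\<exists>k. card (UNIV :: 'a set) = p ^ k"
    and "n \<ge> 1"
    and "lead_coeff f = 1" and "degree f = n" and "irreducible f"
    and "h_eval p n (\<lambda>i. coeff f (n - i)) \<noteq> 0"
  shows "\<forall>(\<phi> :: 'a \<Rightarrow> 'b::field).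
           (\<phi> 1 = 1 \<and> (\<forall>x y. \<phi> (x + y) = \<phi> x + \<phi> y) \<and> (\<forall>x y. \<phi> (x * y) = \<phi> x * \<phi> y)) \<longrightarrow>
           (\<forall>c :: 'b \<Rightarrow> 'a.
              (\<Sum>r\<in>{r. poly (map_poly \<phi> f) r = 0}. \<phi> (c r) * r) = 0 \<longrightarrow>
              (\<forall>r\<in>{r. poly (map_poly \<phi> f) r = 0}. c r = 0))"
proof (intro allI impI ballI, elim conjE)
  fix \<phi> :: "'a \<Rightarrow> 'b" and c :: "'b \<Rightarrow> 'a" and r0 :: 'b
  let ?roots = "{r. poly (map_poly \<phi> f) r = 0}"
  assume \<phi>: "\<phi> 1 = 1" "\<forall>x y. \<phi> (x + y) = \<phi> x + \<phi> y" "\<forall>x y. \<phi> (x * y) = \<phi> x * \<phi> y"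
    and dep: "(\<Sum>r\<in>?roots. \<phi> (c r) * r) = 0" and r0: "r0 \<in> ?roots"
  obtain k where k: "card (UNIV :: 'a set) = p ^ k" using assms(2) by blast
  define q where "q = card (UNIV :: 'a set)"
  interpret finite_field_embedding \<phi> p q k
    using \<phi> assms(1) k by unfold_locales (auto simp: q_def)
  \<comment> \<open>The root of unity \<omega> need not lie in \<open>'b\<close>, so the argument
    moves to its algebraic closure.\<close>
  interpret ac: ring_morphism "to_ac :: 'b \<Rightarrow> 'b alg_closure" by unfold_locales auto
  \<comment> \<open>Numbering the roots from r0 puts the coefficient assumed nonzero at index
    0.\<close>
  define s where "s i = r0 ^ (q ^ i)" for i
  have s: "inj_on s {..<n}" "\<And>i. s (i + n) = s i" "map_poly \<phi> f = (\<Prod>i<n. [:- s i, 1:])"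
    using conjugate_roots[OF assms(4,5,6), of r0] r0 unfolding s_def[abs_def] by simp_all
  have roots: "?roots = s ` {..<n}"
    unfolding s(3) by (auto simp: poly_prod prod_zero_iff)
  have dep_s: "(\<Sum>i<n. \<phi> (c (s i)) * s i) = 0"
    using dep unfolding roots by (simp add: sum.reindex[OF s(1)])
  show "c r0 = 0"
  proof (rule ccontr)
    assume c_r0: "c r0 \<noteq> 0"
    \<comment> \<open>Iterated Frobenius fixes the coefficients, which come from F_q, and shifts the
      roots, so one relation yields all its cyclic shifts.\<close>
    have shifted: "(\<Sum>i<n. to_ac (\<phi> (c (s i))) * to_ac (s (i + j))) = 0" for j
    proof -
      interpret F: ring_morphism "\<lambda>x :: 'b. x ^ (q ^ j)" by (rule ring_morphism_frobenius_iter)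
      have "(\<Sum>i<n. \<phi> (c (s i)) * s i) ^ (q ^ j) = (\<Sum>i<n. \<phi> (c (s i)) * s (i + j))"
        by (simp add: F.map_sum F.map_mult frobenius_iter_fixes s_def power_add power_mult)
      then have "(\<Sum>i<n. \<phi> (c (s i)) * s (i + j)) = 0" using dep_s F.map_0 by simp
      from arg_cong[OF this, of to_ac] show ?thesis by (simp add: ac.map_sum)
    qed
    have nz: "0 < n" "to_ac (\<phi> (c (s 0))) \<noteq> 0" using assms(3) c_r0 by (simp_all add: s_def)
    obtain \<omega> :: "'b alg_closure" where \<omega>: "\<omega> ^ n = 1" "(\<Sum>i<n. \<omega> ^ i * to_ac (s i)) = 0"
      using periodic_dependent_imp_character_sum_0[of n "\<lambda>i. to_ac (s i)" "\<lambda>i. to_ac (\<phi> (c (s i)))" 0]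
        s(2) shifted nz by auto
    have "CHAR('b alg_closure) = p" by (simp add: CHAR_ext)
    then obtain l where l: "primitive_root l \<omega>" "l dvd n div p ^ multiplicity p n"
      using root_of_unity_order[OF assms(1) _ nz(1) \<omega>(1)] by blast
    have m_dvd: "n div p ^ multiplicity p n dvd n"
      using multiplicity_dvd[of p n] by (metis dvd_div_mult_self dvd_triv_left)
    have "l dvd n" using l(2) m_dvd dvd_trans by blast
    define w where "w a = - to_ac (s a)" for a
    have "(\<Sum>a<n. \<omega> ^ a * w a) = 0" using \<omega>(2) by (simp add: w_def sum_negf)
    note theta = theta_eval_eq_0[OF \<open>l dvd n\<close> nz(1) l(1) this]
    define t where "t = mp_eval of_int (\<lambda>i. coeff f (n - i)) (theta n l)"
    have coeffs: "to_ac (\<phi> (coeff f (n - i))) = elem_sym n w i" if "i \<in> {1..n}" for i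
    proof -
      have "to_ac (\<phi> (coeff f (n - i))) = to_ac (coeff (map_poly \<phi> f) (n - i))"
        by (simp add: coeff_map_poly)
      also have "\<dots> = to_ac (elem_sym n (\<lambda>a. - s a) i)"
        unfolding s(3) using that by (subst coeff_prod_linear) auto
      also have "\<dots> = elem_sym n w i"
        by (simp add: ac.map_elem_sym w_def[abs_def])
      finally show ?thesis .
    qed
    have "to_ac (\<phi> t) = mp_eval of_int (\<lambda>i. to_ac (\<phi> (coeff f (n - i)))) (theta n l)"
      by (simp add: t_def map_mp_eval ac.map_mp_eval)
    \<comment> \<open>The two points may differ beyond index n, where n - i is truncated to 0 while
      \<open>elem_sym\<close> vanishes; theta has no variables there.\<close>
    also have "\<dots> = mp_eval of_int (elem_sym n w) (theta n l)"
      by (rule mp_eval_cong) (use theta(2) coeffs in blast)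
    also have "\<dots> = 0" by (rule theta(1))
    finally have "t = 0" by simp
    \<comment> \<open>A product over an infinite set would be 1 by default; the divisors are
      finitely many because m divides n > 0 and so is nonzero.\<close>
    have "finite {l. l dvd n div p ^ multiplicity p n}"
      using nz(1) m_dvd by (intro finite_divisors_nat) (auto intro: Nat.gr0I)
    then have "h_eval p n (\<lambda>i. coeff f (n - i)) = 0"
      unfolding h_eval_def Let_def using l(2) \<open>t = 0\<close> by (intro prod_zero) (auto simp: t_def)
    then show False using assms(7) by simp
  qed
qed

end
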